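(* Let $\delta\in(0,1)$ and suppose Assumptions 1 and 2 (see context) hold; let $\rho\in(\rho(\bar A),1)$. Suppose that, for a scalar $\beta>0$, $$L\gtrsim\frac{\beta\log\big(C_\rho T\|C\|\sqrt{C_{\bar z}C_{\hat x}}\big)}{1-\rho},\qquad C_{\bar z}:=(m+p)L\,\big(\|C\Sigma[\hat x_T]C^\top+\Sigma_e\|+\|\Sigma_u\|\big),\quad C_{\hat x}:=n\|\Sigma[\hat x_T]\|,$$ and that the trajectory length satisfies $$T\gtrsim L\Big((m+p)L\log\Big(\frac{2T\|\Sigma[\bar z_T]\|}{3L\,\lambda_{\min}(\Sigma[\bar z_L])}\Big)+\log(1/\delta)\Big).$$ Then, for any fixed hidden dimension $h\le r$, with probability at least $1-\delta$ the loss landscape of $$\mathcal L_{\mathcal R}(G_1,G_2)=\frac1{2T}\sum_{t=1}^T\|y_{t:t+H-1}-G_2G_1\bar z_t\|_{\ell_2}^2,\qquad G_1\in\mathbb R^{h\times(m+p)L},\ G_2\in\mathbb R^{mH\times h},$$ satisfies: (i) any local minimum is a global minimum; (ii) any saddle point is a strict-saddle point.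
   Context: Definitions for a smooth function $\mathcal L$: $X$ is a critical point if $\nabla\mathcal L(X)=0$; $X$ is a local minimum if $\nabla\mathcal L(X)=0$ and $\lambda_{\min}(\nabla^2\mathcal L(X))\ge0$; $X$ is a strict-saddle point if it is a critical point and $\lambda_{\min}(\nabla^2\mathcal L(X))<0$. A saddle point is a critical point that is not a local minimum. Thus every critical point is a strict saddle or a global minimum. $\|\cdot\|$ is the spectral norm, $\|\cdot\|_{\ell_2}$ the Euclidean norm, $\rho(\cdot)$ the spectral radius; $\gtrsim$ hides constants and logarithmic terms involving the problem variables; $\Sigma[z]:=\mathbb E[zz^\top]$ for a centered random vector $z$; $y_{t:t+H-1}$ is the stacked vector of $y_t,\dots,y_{t+H-1}$; $H\ge1$ is a fixed horizon and $r\ge1$ a fixed upper bound on the hidden dimension. System: $x_{t+1}=Ax_t+Bu_t+w_t$, $y_t=Cx_t+v_t$, $t\ge0$, with $x_t\in\mathbb R^n$, $u_t\in\mathbb R^p$, $y_t\in\mathbb R^m$; one trajectory $\{(u_t,y_t)\}_{t=0}^{T+H}$ is observed. Assumption 1: $\{w_t\},\{v_t\},\{u_t\}$ are (mutually independent) sequences of independent zero-mean Gaussian vectors with covariances $\Sigma_w\succ0$, $\Sigma_v\succ0$, $\Sigma_u\succ0$. Assumption 2: (a) $\rho(A)\le1$; (b) $(A,\Sigma_w^{1/2})$ is stabilizable and $(A,C)$ is observable. Steady-state Kalman filter: let $\Sigma$ be the positive semidefinite solution of the Riccati equation $\Sigma=A\Sigma A^\top-A\Sigma C^\top(C\Sigma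 C^\top+\Sigma_v)^{-1}C\Sigma A^\top+\Sigma_w$, $F=A\Sigma C^\top(C\Sigma C^\top+\Sigma_v)^{-1}$, $\bar A=A-FC$ (under Assumption 2, $\rho(\bar A)<1$). The filter is $\hat x_{t+1}=\bar A\hat x_t+Bu_t+Fy_t$, $y_t=C\hat x_t+e_t$, with $\hat x_0=0$. The initial state satisfies $x_0\sim\mathcal N(0,\Sigma)$, so that the $e_t$ are i.i.d. $\mathcal N(0,\Sigma_e)$ with $\Sigma_e=C\Sigma C^\top+\Sigma_v$, and $\Sigma[\hat x_t]=\sum_{k=0}^{t-1}A^k(B\Sigma_uB^\top+F\Sigma_eF^\top)(A^\top)^k$. $C_\rho:=\sup_{k\ge0}\|\bar A^k\|/\rho^k<\infty$. Covariates for history length $L\ge1$: $\bar z_t=[y_{t-1}^\top\cdots y_{t-L}^\top\ u_{t-1}^\top\cdots u_{t-L}^\top]^\top\in\mathbb R^{(m+p)L}$, with $u_s=0,y_s=0$ for $s\le-1$. *)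

theory Defs
  imports
    "HOL-Probability.Probability"
    "Jordan_Normal_Form.Gauss_Jordan_Elimination"
    "Jordan_Normal_Form.DL_Rank"
    "Jordan_Normal_Form.Spectral_Radius"
begin

text \<open>Vectors and matrices are those of Jordan-Normal-Form, because the dimensions
  vary inside the statement; their notation takes precedence over that of HOL-Analysis.\<close>

unbundle no vec_syntax
hide_type (open) Finite_Cartesian_Product.vec
hide_const (open) Finite_Cartesian_Product.vec Finite_Cartesian_Product.mat

definition l2_norm :: "real vec \<Rightarrow> real" where
  "l2_norm x = sqrt (scalar_prod x x)"

definition spectral_norm :: "real mat \<Rightarrow> real" where
  "spectral_norm A = Sup {l2_norm (A *\<^sub>v x) |x. x \<in> carrier_vec (dim_col A) \<and> l2_norm x \<le> 1}"

definition real_spectral_radius :: "real mat \<Rightarrow> real" where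
  "real_spectral_radius A = spectral_radius (map_mat complex_of_real A)"

text \<open>Used for symmetric matrices of positive dimension only; the set is then finite and nonempty.\<close>

definition lambda_min :: "real mat \<Rightarrow> real" where
  "lambda_min S = Min {k. eigenvalue S k}"

definition pos_semidef :: "nat \<Rightarrow> real mat \<Rightarrow> bool" where
  "pos_semidef n S \<longleftrightarrow> S \<in> carrier_mat n n \<and> S\<^sup>T = S \<and>
     (\<forall>x \<in> carrier_vec n. scalar_prod x (S *\<^sub>v x) \<ge> 0)"

definition pos_def :: "nat \<Rightarrow> real mat \<Rightarrow> bool" where
  "pos_def n S \<longleftrightarrow> S \<in> carrier_mat n n \<and> S\<^sup>T = S \<and>
     (\<forall>x \<in> carrier_vec n. x \<noteq> 0\<^sub>v n \<longrightarrow> scalar_prod x (S *\<^sub>v x) > 0)"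

definition psd_sqrt :: "nat \<Rightarrow> real mat \<Rightarrow> real mat" where
  "psd_sqrt n S = (THE R. pos_semidef n R \<and> R * R = S)"

text \<open>Used for invertible matrices only.\<close>

definition mat_inv :: "real mat \<Rightarrow> real mat" where
  "mat_inv S = the (mat_inverse S)"

text \<open>The Borel sigma-algebra on the vectors of dimension \<open>d\<close>, transported from the
  product of \<open>d\<close> copies of the real line.\<close>

definition vec_borel :: "nat \<Rightarrow> real vec measure" where
  "vec_borel d = vimage_algebra (carrier_vec d) (\<lambda>x. \<lambda>i\<in>{..<d}. x $ i)
     (Pi\<^sub>M {..<d} (\<lambda>_. borel))"

text \<open>\<open>X\<close> has law \<open>N(0, S)\<close>: every linear functional \<open>a \<bullet> X\<close> is a centered normal variable of
  variance \<open>a \<bullet> S a\<close>, which is the point mass at \<open>0\<close> when this variance vanishes.\<close>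

definition centered_gaussian_vec ::
  "'w measure \<Rightarrow> nat \<Rightarrow> ('w \<Rightarrow> real vec) \<Rightarrow> real mat \<Rightarrow> bool" where
  "centered_gaussian_vec M d X S \<longleftrightarrow> X \<in> M \<rightarrow>\<^sub>M vec_borel d \<and> pos_semidef d S \<and>
     (\<forall>a \<in> carrier_vec d. let s2 = scalar_prod a (S *\<^sub>v a) in
        if s2 = 0 then (AE \<omega> in M. scalar_prod a (X \<omega>) = 0)
        else distributed M lborel (\<lambda>\<omega>. scalar_prod a (X \<omega>)) (\<lambda>s. ennreal (normal_density 0 (sqrt s2) s)))"

text \<open>The matrix \<open>E[z z\<^sup>T]\<close> of a random vector \<open>z\<close> of dimension \<open>d\<close>.\<close>

definition cov_mat :: "'w measure \<Rightarrow> nat \<Rightarrow> ('w \<Rightarrow> real vec) \<Rightarrow> real mat" where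
  "cov_mat M d z = mat d d (\<lambda>(i, j). \<integral>\<omega>. z \<omega> $ i * z \<omega> $ j \<partial>M)"

datatype noise_source = Initial | Process nat | Measurement nat | Input nat

primrec source_dim :: "nat \<Rightarrow> nat \<Rightarrow> nat \<Rightarrow> noise_source \<Rightarrow> nat" where
  "source_dim n m p Initial = n"
| "source_dim n m p (Process t) = n"
| "source_dim n m p (Measurement t) = m"
| "source_dim n m p (Input t) = p"

primrec source_vec :: "('w \<Rightarrow> real vec) \<Rightarrow> (nat \<Rightarrow> 'w \<Rightarrow> real vec) \<Rightarrow> (nat \<Rightarrow> 'w \<Rightarrow> real vec) \<Rightarrow>
    (nat \<Rightarrow> 'w \<Rightarrow> real vec) \<Rightarrow> noise_source \<Rightarrow> 'w \<Rightarrow> real vec" where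
  "source_vec x0 w v u Initial = x0"
| "source_vec x0 w v u (Process t) = w t"
| "source_vec x0 w v u (Measurement t) = v t"
| "source_vec x0 w v u (Input t) = u t"

definition gaussian_sources ::
  "'w measure \<Rightarrow> nat \<Rightarrow> nat \<Rightarrow> nat \<Rightarrow> real mat \<Rightarrow> real mat \<Rightarrow> real mat \<Rightarrow> real mat \<Rightarrow>
   ('w \<Rightarrow> real vec) \<Rightarrow> (nat \<Rightarrow> 'w \<Rightarrow> real vec) \<Rightarrow> (nat \<Rightarrow> 'w \<Rightarrow> real vec) \<Rightarrow>
   (nat \<Rightarrow> 'w \<Rightarrow> real vec) \<Rightarrow> bool" where
  "gaussian_sources M n m p S0 Sw Sv Su x0 w v u \<longleftrightarrow>
     pos_def n Sw \<and> pos_def m Sv \<and> pos_def p Su \<and>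
     centered_gaussian_vec M n x0 S0 \<and>
     (\<forall>t. centered_gaussian_vec M n (w t) Sw) \<and>
     (\<forall>t. centered_gaussian_vec M m (v t) Sv) \<and>
     (\<forall>t. centered_gaussian_vec M p (u t) Su) \<and>
     prob_space.indep_vars M (\<lambda>s. vec_borel (source_dim n m p s)) (source_vec x0 w v u) UNIV"

definition linear_system ::
  "'w measure \<Rightarrow> real mat \<Rightarrow> real mat \<Rightarrow> real mat \<Rightarrow> (nat \<Rightarrow> 'w \<Rightarrow> real vec) \<Rightarrow>
   (nat \<Rightarrow> 'w \<Rightarrow> real vec) \<Rightarrow> (nat \<Rightarrow> 'w \<Rightarrow> real vec) \<Rightarrow> (nat \<Rightarrow> 'w \<Rightarrow> real vec) \<Rightarrow>
   (nat \<Rightarrow> 'w \<Rightarrow> real vec) \<Rightarrow> bool" where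
  "linear_system M A B C x u w v y \<longleftrightarrow> (\<forall>\<omega> \<in> space M. \<forall>t.
     x (Suc t) \<omega> = A *\<^sub>v x t \<omega> + B *\<^sub>v u t \<omega> + w t \<omega> \<and> y t \<omega> = C *\<^sub>v x t \<omega> + v t \<omega>)"

definition stabilizable :: "nat \<Rightarrow> real mat \<Rightarrow> real mat \<Rightarrow> bool" where
  "stabilizable n A B \<longleftrightarrow>
     (\<exists>K \<in> carrier_mat (dim_col B) n. real_spectral_radius (A + B * K) < 1)"

text \<open>The matrix with the blocks \<open>C, C A, \<dots>, C A^(n-1)\<close> stacked on top of each other.\<close>

definition observability_mat :: "nat \<Rightarrow> nat \<Rightarrow> real mat \<Rightarrow> real mat \<Rightarrow> real mat" where
  "observability_mat n m A C = mat (n * m) n (\<lambda>(i, j). (C * A ^\<^sub>m (i div m)) $$ (i mod m, j))"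

definition observable :: "nat \<Rightarrow> nat \<Rightarrow> real mat \<Rightarrow> real mat \<Rightarrow> bool" where
  "observable n m A C \<longleftrightarrow> vec_space.rank (n * m) (observability_mat n m A C) = n"

definition innovation_cov :: "real mat \<Rightarrow> real mat \<Rightarrow> real mat \<Rightarrow> real mat" where
  "innovation_cov C Sv S = C * S * C\<^sup>T + Sv"

definition riccati_solution ::
  "nat \<Rightarrow> real mat \<Rightarrow> real mat \<Rightarrow> real mat \<Rightarrow> real mat \<Rightarrow> real mat \<Rightarrow> bool" where
  "riccati_solution n A C Sw Sv S \<longleftrightarrow> pos_semidef n S \<and>
     S = A * S * A\<^sup>T - A * S * C\<^sup>T * mat_inv (innovation_cov C Sv S) * C * S * A\<^sup>T + Sw"

definition kalman_gain :: "real mat \<Rightarrow> real mat \<Rightarrow> real mat \<Rightarrow> real mat \<Rightarrow> real mat" where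
  "kalman_gain A C Sv S = A * S * C\<^sup>T * mat_inv (innovation_cov C Sv S)"

primrec kalman_state ::
  "nat \<Rightarrow> real mat \<Rightarrow> real mat \<Rightarrow> real mat \<Rightarrow> (nat \<Rightarrow> real vec) \<Rightarrow> (nat \<Rightarrow> real vec) \<Rightarrow>
   nat \<Rightarrow> real vec" where
  "kalman_state n Abar B F u y 0 = 0\<^sub>v n"
| "kalman_state n Abar B F u y (Suc t) =
     Abar *\<^sub>v kalman_state n Abar B F u y t + B *\<^sub>v u t + F *\<^sub>v y t"

definition power_bound :: "real mat \<Rightarrow> real \<Rightarrow> real" where
  "power_bound A \<rho> = (SUP k. spectral_norm (A ^\<^sub>m k) / \<rho> ^ k)"

text \<open>\<open>[y(t-1), \<dots>, y(t-L), u(t-1), \<dots>, u(t-L)]\<close>, where entries at negative times are \<open>0\<close>.\<close>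

definition lagged :: "nat \<Rightarrow> nat \<Rightarrow> (nat \<Rightarrow> real vec) \<Rightarrow> nat \<Rightarrow> real vec" where
  "lagged d L s t = vec (d * L) (\<lambda>i. if i div d < t then s (t - 1 - i div d) $ (i mod d) else 0)"

definition covariate ::
  "nat \<Rightarrow> nat \<Rightarrow> nat \<Rightarrow> (nat \<Rightarrow> real vec) \<Rightarrow> (nat \<Rightarrow> real vec) \<Rightarrow> nat \<Rightarrow> real vec" where
  "covariate m p L y u t = lagged m L y t @\<^sub>v lagged p L u t"

definition stacked :: "nat \<Rightarrow> nat \<Rightarrow> (nat \<Rightarrow> real vec) \<Rightarrow> nat \<Rightarrow> real vec" where
  "stacked d H s t = vec (d * H) (\<lambda>i. s (t + i div d) $ (i mod d))"

definition regression_loss ::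
  "nat \<Rightarrow> nat \<Rightarrow> nat \<Rightarrow> nat \<Rightarrow> nat \<Rightarrow> (nat \<Rightarrow> real vec) \<Rightarrow> (nat \<Rightarrow> real vec) \<Rightarrow>
   real mat \<Rightarrow> real mat \<Rightarrow> real" where
  "regression_loss m p H L T y u G1 G2 = 1 / (2 * real T) *
     (\<Sum>t = 1..T. (l2_norm (stacked m H y t - (G2 * G1) *\<^sub>v covariate m p L y u t))\<^sup>2)"

text \<open>A pair of matrices of sizes \<open>h \<times> k\<close> and \<open>q \<times> h\<close> is identified with the vector of dimension
  \<open>h * k + q * h\<close> that lists the entries of both, row by row.\<close>

definition first_factor :: "nat \<Rightarrow> nat \<Rightarrow> real vec \<Rightarrow> real mat" where
  "first_factor h k X = mat h k (\<lambda>(i, j). X $ (i * k + j))"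

definition second_factor :: "nat \<Rightarrow> nat \<Rightarrow> nat \<Rightarrow> real vec \<Rightarrow> real mat" where
  "second_factor h k q X = mat q h (\<lambda>(i, j). X $ (h * k + i * h + j))"

definition partial_deriv :: "nat \<Rightarrow> (real vec \<Rightarrow> real) \<Rightarrow> nat \<Rightarrow> real vec \<Rightarrow> real" where
  "partial_deriv d f i X = deriv (\<lambda>s. f (X + s \<cdot>\<^sub>v unit_vec d i)) 0"

definition gradient :: "nat \<Rightarrow> (real vec \<Rightarrow> real) \<Rightarrow> real vec \<Rightarrow> real vec" where
  "gradient d f X = vec d (\<lambda>i. partial_deriv d f i X)"

definition hessian :: "nat \<Rightarrow> (real vec \<Rightarrow> real) \<Rightarrow> real vec \<Rightarrow> real mat" where
  "hessian d f X = mat d d (\<lambda>(i, j). partial_deriv d (partial_deriv d f j) i X)"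

definition critical_point :: "nat \<Rightarrow> (real vec \<Rightarrow> real) \<Rightarrow> real vec \<Rightarrow> bool" where
  "critical_point d f X \<longleftrightarrow> X \<in> carrier_vec d \<and> gradient d f X = 0\<^sub>v d"

text \<open>A local minimum is understood as a second-order stationary point.\<close>

definition local_minimum :: "nat \<Rightarrow> (real vec \<Rightarrow> real) \<Rightarrow> real vec \<Rightarrow> bool" where
  "local_minimum d f X \<longleftrightarrow> critical_point d f X \<and> lambda_min (hessian d f X) \<ge> 0"

definition saddle_point :: "nat \<Rightarrow> (real vec \<Rightarrow> real) \<Rightarrow> real vec \<Rightarrow> bool" where
  "saddle_point d f X \<longleftrightarrow> critical_point d f X \<and> \<not> local_minimum d f X"

definition strict_saddle_point :: "nat \<Rightarrow> (real vec \<Rightarrow> real) \<Rightarrow> real vec \<Rightarrow> bool" where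
  "strict_saddle_point d f X \<longleftrightarrow> critical_point d f X \<and> lambda_min (hessian d f X) < 0"

definition global_minimum :: "nat \<Rightarrow> (real vec \<Rightarrow> real) \<Rightarrow> real vec \<Rightarrow> bool" where
  "global_minimum d f X \<longleftrightarrow> X \<in> carrier_vec d \<and> (\<forall>Y \<in> carrier_vec d. f X \<le> f Y)"

end

theory Submission
  imports Defs
begin

text \<open>The two claims hold for every sample path, so the event in question is the whole probability
  space. Claim (ii) is immediate from the definitions. For claim (i), let \<open>X = G\<^sub>1 Z\<close>, \<open>M = G\<^sub>2 X\<close>, and
  let \<open>N = M + E\<close> be the projection of the data onto the row space of the covariate matrix \<open>Z\<close>, which
  may well be rank deficient. The first-order conditions say that \<open>G\<^sub>2\<^sup>T E = 0\<close> and \<open>E X\<^sup>T = 0\<close>.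
  If \<open>G\<^sub>2\<close> has a kernel, the second-order condition along directions that use a kernel vector forces
  \<open>E = 0\<close>. Otherwise, rank-one directions give \<open>\<parallel>u\<parallel>\<^sup>2 \<parallel>E\<^sup>T v\<parallel>\<^sup>2 \<le> \<parallel>v\<parallel>\<^sup>2 \<parallel>M\<^sup>T u\<parallel>\<^sup>2\<close> for all \<open>u\<close> in the
  range of \<open>G\<^sub>2\<close> and all \<open>v\<close> orthogonal to it, hence a threshold \<open>\<sigma>\<close> that separates the squared
  singular values of \<open>E\<close> from the \<open>h\<close> largest ones of \<open>M\<close>. A trace estimate in the style of
  Eckart and Young then shows that no matrix of rank at most \<open>h\<close> is closer to \<open>N\<close> than \<open>M\<close>.\<close>

subsection \<open>Orthonormal families\<close>

text \<open>Complete the square in each coefficient \<open>\<kappa> i\<close>. The last sum vanishes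
  at the Fourier coefficients of \<open>f\<close>, and dropping it bounds the error of any other
  combination from below; for \<open>f = 0\<close> only the squared norm of the combination
  remains.\<close>

lemma bessel_identity:
  fixes v :: "nat \<Rightarrow> 'i \<Rightarrow> real"
  assumes orth: "\<And>i j. i < m \<Longrightarrow> j < m \<Longrightarrow> (\<Sum>x\<in>I. v i x * v j x) = of_bool (i = j)"
  shows "(\<Sum>x\<in>I. (f x - (\<Sum>i<m. \<kappa> i * v i x))\<^sup>2) =
    (\<Sum>x\<in>I. (f x)\<^sup>2) - (\<Sum>i<m. (\<Sum>x\<in>I. f x * v i x)\<^sup>2) + (\<Sum>i<m. (\<kappa> i - (\<Sum>x\<in>I. f x * v i x))\<^sup>2)"
proof -
  have cross: "(\<Sum>x\<in>I. f x * (\<Sum>i<m. \<kappa> i * v i x)) = (\<Sum>i<m. \<kappa> i * (\<Sum>x\<in>I. f x * v i x))"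
    unfolding sum_distrib_left by (subst sum.swap) (simp add: algebra_simps)
  have "(\<Sum>x\<in>I. (\<Sum>i<m. \<kappa> i * v i x)\<^sup>2) = (\<Sum>x\<in>I. \<Sum>i<m. \<Sum>j<m. \<kappa> i * \<kappa> j * (v i x * v j x))"
    unfolding power2_eq_square sum_product by (simp add: algebra_simps)
  also have "\<dots> = (\<Sum>i<m. \<Sum>j<m. \<Sum>x\<in>I. \<kappa> i * \<kappa> j * (v i x * v j x))"
    by (subst sum.swap, rule sum.cong[OF refl], rule sum.swap)
  also have "\<dots> = (\<Sum>i<m. \<Sum>j<m. if i = j then (\<kappa> i)\<^sup>2 else 0)"
    unfolding sum_distrib_left[symmetric]
    by (intro sum.cong refl) (auto simp: orth power2_eq_square)
  also have "\<dots> = (\<Sum>i<m. (\<kappa> i)\<^sup>2)" by simp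
  finally have sq: "(\<Sum>x\<in>I. (\<Sum>i<m. \<kappa> i * v i x)\<^sup>2) = (\<Sum>i<m. (\<kappa> i)\<^sup>2)" .
  have "(\<Sum>x\<in>I. (f x - (\<Sum>i<m. \<kappa> i * v i x))\<^sup>2) =
     (\<Sum>x\<in>I. (f x)\<^sup>2) - 2 * (\<Sum>x\<in>I. f x * (\<Sum>i<m. \<kappa> i * v i x)) + (\<Sum>x\<in>I. (\<Sum>i<m. \<kappa> i * v i x)\<^sup>2)"
    by (simp add: power2_diff sum.distrib sum_subtractf sum_distrib_left algebra_simps)
  then show ?thesis
    unfolding cross sq by (simp add: power2_diff sum.distrib sum_subtractf sum_distrib_left algebra_simps)
qed

lemma residual_orthogonal:
  fixes v :: "nat \<Rightarrow> 'i \<Rightarrow> real"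
  assumes orth: "\<And>i j. i < m \<Longrightarrow> j < m \<Longrightarrow> (\<Sum>x\<in>I. v i x * v j x) = of_bool (i = j)"
    and i: "i < m"
  shows "(\<Sum>x\<in>I. (f x - (\<Sum>j<m. (\<Sum>x\<in>I. f x * v j x) * v j x)) * v i x) = 0"
proof -
  define p where "p i = (\<Sum>x\<in>I. f x * v i x)" for i
  have "(\<Sum>x\<in>I. (f x - (\<Sum>j<m. p j * v j x)) * v i x) = p i - (\<Sum>x\<in>I. \<Sum>j<m. p j * (v j x * v i x))"
    unfolding p_def by (simp add: left_diff_distrib sum_subtractf sum_distrib_right mult.assoc)
  also have "\<dots> = p i - (\<Sum>j<m. p j * (\<Sum>x\<in>I. v j x * v i x))"
    by (subst sum.swap) (simp add: sum_distrib_left)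
  also have "(\<Sum>j<m. p j * (\<Sum>x\<in>I. v j x * v i x)) = (\<Sum>j<m. if j = i then p j else 0)"
    using i by (intro sum.cong refl) (auto simp: orth)
  also have "p i - \<dots> = 0" using i by simp
  finally show ?thesis unfolding p_def .
qed

text \<open>Gram-Schmidt that discards vanishing residuals, so dependent inputs are allowed and
  \<open>m\<close> may drop below \<open>h\<close>. The coefficients \<open>c\<close> and
  \<open>d\<close> express each family through the other; the relation with \<open>d\<close> is
  restricted to \<open>I\<close> because a residual of norm zero is known to vanish only
  there.\<close>

lemma gram_schmidt_family:
  fixes a :: "nat \<Rightarrow> 'i \<Rightarrow> real"
  assumes "finite I"
  shows "\<exists>m\<le>h. \<exists>v c d.
    (\<forall>i<m. \<forall>j<m. (\<Sum>x\<in>I. v i x * v j x) = of_bool (i = j)) \<and>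
    (\<forall>i<m. \<forall>x. v i x = (\<Sum>j<h. c i j * a j x)) \<and>
    (\<forall>j<h. \<forall>x\<in>I. a j x = (\<Sum>i<m. d j i * v i x)) \<and>
    ((\<forall>\<alpha>. (\<forall>x\<in>I. (\<Sum>j<h. \<alpha> j * a j x) = 0) \<longrightarrow> (\<forall>j<h. \<alpha> j = 0)) \<longrightarrow> m = h)"
proof (induction h)
  case 0
  show ?case by auto
next
  case (Suc h)
  then obtain m v c d where m: "m \<le> h"
    and family: "\<forall>i<m. \<forall>j<m. (\<Sum>x\<in>I. v i x * v j x) = of_bool (i = j)"
      "\<forall>i<m. \<forall>x. v i x = (\<Sum>j<h. c i j * a j x)"
      "\<forall>j<h. \<forall>x\<in>I. a j x = (\<Sum>i<m. d j i * v i x)"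
    and ind: "(\<forall>\<alpha>. (\<forall>x\<in>I. (\<Sum>j<h. \<alpha> j * a j x) = 0) \<longrightarrow> (\<forall>j<h. \<alpha> j = 0)) \<longrightarrow> m = h"
    by (elim exE conjE) (rule that)
  note orth = family(1)[rule_format] and c = family(2)[rule_format] and d = family(3)[rule_format]
  define p where "p i = (\<Sum>x\<in>I. a h x * v i x)" for i
  define r where "r x = a h x - (\<Sum>i<m. p i * v i x)" for x
  define g where "g j = (\<Sum>i<m. p i * c i j)" for j
  have r_alt: "r x = a h x - (\<Sum>j<h. g j * a j x)" for x
    unfolding r_def g_def by (simp add: c sum_distrib_left sum_distrib_right mult.assoc) (rule sum.swap)
  have r_orth: "(\<Sum>x\<in>I. r x * v i x) = 0" if "i < m" for i
    unfolding r_def p_def by (rule residual_orthogonal[OF orth that])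
  show ?case
  proof (cases "(\<Sum>x\<in>I. r x * r x) = 0")
    case True
    then have r0: "r x = 0" if "x \<in> I" for x
      using that assms by (subst (asm) sum_nonneg_eq_0_iff) auto
    let ?c = "\<lambda>i j. if j = h then 0 else c i j"
    let ?d = "\<lambda>j. if j = h then p else d j"
    have 1: "\<forall>i<m. \<forall>x. v i x = (\<Sum>j<Suc h. ?c i j * a j x)" by (simp add: c)
    have 2: "\<forall>j<Suc h. \<forall>x\<in>I. a j x = (\<Sum>i<m. ?d j i * v i x)"
      using r0 by (auto simp: less_Suc_eq r_def d)
    \<comment> \<open>The vanishing residual is a linear relation with coefficient 1 at
      \<open>h\<close>, so independence fails and the claim \<open>m = Suc h\<close> is
      vacuous.\<close>
    have "\<forall>x\<in>I. (\<Sum>j<Suc h. (if j = h then 1 else - g j) * a j x) = 0"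
      using r0 by (auto simp: r_alt sum_negf)
    then have 3: "(\<forall>\<alpha>. (\<forall>x\<in>I. (\<Sum>j<Suc h. \<alpha> j * a j x) = 0) \<longrightarrow> (\<forall>j<Suc h. \<alpha> j = 0)) \<longrightarrow> m = Suc h"
      by (intro impI, drule_tac x = "\<lambda>j. if j = h then 1 else - g j" in spec) auto
    have "m \<le> Suc h" using m by simp
    then show ?thesis
      using family(1) 1 2 3
      by (intro exI[of _ m] conjI exI[of _ v] exI[of _ ?c] exI[of _ ?d])
  next
    case False
    define s where "s = sqrt (\<Sum>x\<in>I. r x * r x)"
    have s: "s > 0" "s * s = (\<Sum>x\<in>I. r x * r x)"
      using False sum_nonneg[of I "\<lambda>x. r x * r x"] unfolding s_def by (auto simp: less_le)
    let ?v = "v(m := \<lambda>x. r x / s)"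
    let ?c = "\<lambda>i j. if i = m then (if j = h then 1 / s else - g j / s) else if j = h then 0 else c i j"
    let ?d = "\<lambda>j i. if j = h then (if i = m then s else p i) else if i = m then 0 else d j i"
    have rr: "(\<Sum>x\<in>I. v i x * r x) = 0" if "i < m" for i using r_orth[OF that] by (simp add: mult.commute)
    have 0: "\<forall>i<Suc m. \<forall>j<Suc m. (\<Sum>x\<in>I. ?v i x * ?v j x) = of_bool (i = j)"
      using s by (auto simp: less_Suc_eq orth r_orth rr sum_divide_distrib[symmetric])
    have 1: "\<forall>i<Suc m. \<forall>x. ?v i x = (\<Sum>j<Suc h. ?c i j * a j x)"
      using s by (auto simp: less_Suc_eq c r_alt sum_negf sum_divide_distrib[symmetric] diff_divide_distrib)
    have 2: "\<forall>j<Suc h. \<forall>x\<in>I. a j x = (\<Sum>i<Suc m. ?d j i * ?v i x)"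
      using s by (auto simp: less_Suc_eq d r_def)
    have 3: "(\<forall>\<alpha>. (\<forall>x\<in>I. (\<Sum>j<Suc h. \<alpha> j * a j x) = 0) \<longrightarrow> (\<forall>j<Suc h. \<alpha> j = 0)) \<longrightarrow> Suc m = Suc h"
    proof
      assume ind': "\<forall>\<alpha>. (\<forall>x\<in>I. (\<Sum>j<Suc h. \<alpha> j * a j x) = 0) \<longrightarrow> (\<forall>j<Suc h. \<alpha> j = 0)"
      \<comment> \<open>A relation among the first \<open>h\<close> functions, extended by 0 at
        \<open>h\<close>, is a relation among all \<open>Suc h\<close>.\<close>
      have "\<alpha> j = 0" if "\<forall>x\<in>I. (\<Sum>j<h. \<alpha> j * a j x) = 0" "j < h" for \<alpha> :: "nat \<Rightarrow> real" and j
        using ind'[rule_format, of "\<alpha>(h := 0)" j] that by simp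
      then show "Suc m = Suc h" using ind by auto
    qed
    have "Suc m \<le> Suc h" using m by simp
    then show ?thesis
      using 0 1 2 3
      by (intro exI[of _ "Suc m"] conjI exI[of _ ?v] exI[of _ ?c] exI[of _ ?d])
  qed
qed

text \<open>The normal equations are solvable even for linearly dependent \<open>z b\<close>:
  project onto an orthonormal family with the same span, then pull the coefficients back through
  \<open>c\<close> and the orthogonality through \<open>d\<close>.\<close>

lemma least_squares_exists:
  fixes z :: "nat \<Rightarrow> 'i \<Rightarrow> real"
  assumes "finite I"
  obtains w where "\<And>b. b < k \<Longrightarrow> (\<Sum>x\<in>I. (y x - (\<Sum>b<k. w b * z b x)) * z b x) = 0"
proof -
  obtain m v c d where "m \<le> k"
    and family: "\<forall>i<m. \<forall>j<m. (\<Sum>x\<in>I. v i x * v j x) = of_bool (i = j)"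
      "\<forall>i<m. \<forall>x. v i x = (\<Sum>j<k. c i j * z j x)"
      "\<forall>j<k. \<forall>x\<in>I. z j x = (\<Sum>i<m. d j i * v i x)"
    using gram_schmidt_family[OF assms, of k z] by (elim exE conjE) (rule that)
  note orth = family(1)[rule_format] and c = family(2)[rule_format] and d = family(3)[rule_format]
  define p where "p i = (\<Sum>x\<in>I. y x * v i x)" for i
  define w where "w j = (\<Sum>i<m. p i * c i j)" for j
  have w: "(\<Sum>b<k. w b * z b x) = (\<Sum>i<m. p i * v i x)" for x
    unfolding w_def by (simp add: c sum_distrib_left sum_distrib_right mult.assoc) (rule sum.swap)
  have res: "(\<Sum>x\<in>I. (y x - (\<Sum>b<k. w b * z b x)) * v i x) = 0" if "i < m" for i
    unfolding w p_def by (rule residual_orthogonal[OF orth that])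
  have "(\<Sum>x\<in>I. (y x - (\<Sum>b<k. w b * z b x)) * z b x) = 0" if b: "b < k" for b
  proof -
    have "(\<Sum>x\<in>I. (y x - (\<Sum>b<k. w b * z b x)) * z b x) =
      (\<Sum>x\<in>I. \<Sum>i<m. d b i * ((y x - (\<Sum>b<k. w b * z b x)) * v i x))"
      by (intro sum.cong refl, subst d[OF b], assumption)
        (simp only: sum_distrib_left, intro sum.cong refl, simp add: mult.left_commute)
    also have "\<dots> = (\<Sum>i<m. d b i * (\<Sum>x\<in>I. (y x - (\<Sum>b<k. w b * z b x)) * v i x))"
      by (subst sum.swap) (simp add: sum_distrib_left)
    also have "\<dots> = 0" by (simp add: res)
    finally show ?thesis .
  qed
  then show ?thesis by (rule that)
qed

subsection \<open>Low-rank approximation\<close>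

text \<open>An Eckart-Young bound without singular values. The competitor has its columns in a space
  with orthonormal basis \<open>v i\<close>, \<open>i < m \<le> h\<close>, so its error is at least
  the squared norm of N = M + E minus what the \<open>v i\<close> capture. It remains to see that
  they capture at most the squared norm of \<open>M\<close>. The hypothesis \<open>gap\<close>, free
  of division, says that Rayleigh quotients of E E^T off the range of \<open>G\<close> never exceed
  those of M M^T on it.\<close>

lemma low_rank_error_bound:
  fixes G W :: "nat \<Rightarrow> 'i \<Rightarrow> real" and X V :: "nat \<Rightarrow> 't \<Rightarrow> real" and M E :: "'i \<Rightarrow> 't \<Rightarrow> real"
  assumes fin: "finite I" "finite S" and h: "h \<ge> 1"
    and M: "\<And>a t. M a t = (\<Sum>j<h. G j a * X j t)"
    and GE: "\<And>j t. j < h \<Longrightarrow> t \<in> S \<Longrightarrow> (\<Sum>a\<in>I. G j a * E a t) = 0"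
    and EX: "\<And>j a. j < h \<Longrightarrow> a \<in> I \<Longrightarrow> (\<Sum>t\<in>S. E a t * X j t) = 0"
    and indep: "\<And>\<alpha>. \<forall>a\<in>I. (\<Sum>j<h. \<alpha> j * G j a) = 0 \<Longrightarrow> \<forall>j<h. \<alpha> j = 0"
    and gap: "\<And>\<alpha> v. (\<And>j. j < h \<Longrightarrow> (\<Sum>a\<in>I. G j a * v a) = 0) \<Longrightarrow>
      (\<Sum>a\<in>I. (\<Sum>j<h. \<alpha> j * G j a)\<^sup>2) * (\<Sum>t\<in>S. (\<Sum>a\<in>I. v a * E a t)\<^sup>2) \<le>
      (\<Sum>a\<in>I. (v a)\<^sup>2) * (\<Sum>t\<in>S. (\<Sum>a\<in>I. (\<Sum>j<h. \<alpha> j * G j a) * M a t)\<^sup>2)"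
  shows "(\<Sum>t\<in>S. \<Sum>a\<in>I. (E a t)\<^sup>2) \<le>
    (\<Sum>t\<in>S. \<Sum>a\<in>I. (M a t + E a t - (\<Sum>j<h. W j a * V j t))\<^sup>2)"
proof -
  define nrm where "nrm v = (\<Sum>a\<in>I. (v a)\<^sup>2)" for v :: "'i \<Rightarrow> real"
  define sq where "sq f = (\<Sum>t\<in>S. (f t)\<^sup>2)" for f :: "'t \<Rightarrow> real"
  define app where "app F v t = (\<Sum>a\<in>I. v a * F a t)" for F :: "'i \<Rightarrow> 't \<Rightarrow> real" and v t
  define comb where "comb \<alpha> a = (\<Sum>j<h. \<alpha> j * G j a)" for \<alpha> a
  have nn: "nrm v \<ge> 0" "sq f \<ge> 0" for v f
    unfolding nrm_def sq_def by (simp_all add: sum_nonneg)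

  \<comment> \<open>The separating threshold \<open>\<sigma>\<close>\<close>
  define \<sigma> where "\<sigma> = Inf {sq (app M (comb \<alpha>)) / nrm (comb \<alpha>) |\<alpha>. nrm (comb \<alpha>) \<noteq> 0}"
  \<comment> \<open>\<open>\<sigma>\<close> is the infimum of the Rayleigh quotients of M M^T on the
    range of \<open>G\<close>. The set is nonempty: by \<open>h \<ge> 1\<close> and independence,
    coefficients all equal to 1 give a nonzero vector.\<close>
  have ex: "{sq (app M (comb \<alpha>)) / nrm (comb \<alpha>) |\<alpha>. nrm (comb \<alpha>) \<noteq> 0} \<noteq> {}"
  proof -
    have "\<not> (\<forall>j<h. (1::real) = 0)" using h by (intro notI) (drule spec[of _ 0], simp)
    then have "\<not> (\<forall>a\<in>I. comb (\<lambda>j. 1) a = 0)" using indep[of "\<lambda>j. 1"] unfolding comb_def by blast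
    then have "nrm (comb (\<lambda>j. 1)) \<noteq> 0"
      unfolding nrm_def using fin(1) by (subst sum_nonneg_eq_0_iff) auto
    then show ?thesis by blast
  qed
  have bdd: "bdd_below {sq (app M (comb \<alpha>)) / nrm (comb \<alpha>) |\<alpha>. nrm (comb \<alpha>) \<noteq> 0}"
    by (rule bdd_belowI[of _ 0]) (auto simp: nn)
  have \<sigma>0: "\<sigma> \<ge> 0"
    unfolding \<sigma>_def by (rule cInf_greatest[OF ex]) (auto simp: nn)
  have \<sigma>_lower: "\<sigma> * nrm (comb \<alpha>) \<le> sq (app M (comb \<alpha>))" for \<alpha>
  proof (cases "nrm (comb \<alpha>) = 0")
    case False
    then have "\<sigma> \<le> sq (app M (comb \<alpha>)) / nrm (comb \<alpha>)"
      unfolding \<sigma>_def by (intro cInf_lower bdd) blast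
    then show ?thesis using False nn(1)[of "comb \<alpha>"] by (simp add: pos_le_divide_eq)
  qed (simp add: nn)
  \<comment> \<open>By \<open>gap\<close>, a quotient of E E^T off the range of \<open>G\<close> is
    a lower bound of the set that defines \<open>\<sigma>\<close>.\<close>
  have \<sigma>_upper: "sq (app E v) \<le> \<sigma> * nrm v" if v: "\<And>j. j < h \<Longrightarrow> (\<Sum>a\<in>I. G j a * v a) = 0" for v
  proof (cases "nrm v = 0")
    case True
    then have "v a = 0" if "a \<in> I" for a
      using that fin(1) unfolding nrm_def by (subst (asm) sum_nonneg_eq_0_iff) auto
    then show ?thesis unfolding True by (simp add: sq_def app_def)
  next
    case False
    then have pos: "nrm v > 0" using nn(1)[of v] by simp
    have "sq (app E v) / nrm v \<le> \<sigma>"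
      unfolding \<sigma>_def
    proof (rule cInf_greatest[OF ex])
      fix q assume "q \<in> {sq (app M (comb \<alpha>)) / nrm (comb \<alpha>) |\<alpha>. nrm (comb \<alpha>) \<noteq> 0}"
      then obtain \<alpha> where \<alpha>: "q = sq (app M (comb \<alpha>)) / nrm (comb \<alpha>)" "nrm (comb \<alpha>) \<noteq> 0" by blast
      have "nrm (comb \<alpha>) * sq (app E v) \<le> nrm v * sq (app M (comb \<alpha>))"
        using gap[OF v, of \<alpha>] unfolding nrm_def sq_def app_def comb_def .
      moreover have "nrm (comb \<alpha>) > 0" using \<alpha>(2) nn(1)[of "comb \<alpha>"] by simp
      ultimately show "sq (app E v) / nrm v \<le> q"
        unfolding \<alpha>(1) using pos by (simp add: pos_divide_le_eq pos_le_divide_eq mult.commute)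
    qed
    then show ?thesis using pos by (simp add: pos_divide_le_eq)
  qed

  \<comment> \<open>Orthonormal basis of the range of \<open>G\<close>\<close>
  obtain m\<^sub>0 u c d where "m\<^sub>0 \<le> h"
    and U: "\<forall>i<m\<^sub>0. \<forall>j<m\<^sub>0. (\<Sum>x\<in>I. u i x * u j x) = of_bool (i = j)"
      "\<forall>i<m\<^sub>0. \<forall>x. u i x = (\<Sum>j<h. c i j * G j x)"
      "\<forall>j<h. \<forall>x\<in>I. G j x = (\<Sum>i<m\<^sub>0. d j i * u i x)"
    and Uh: "(\<forall>\<alpha>. (\<forall>x\<in>I. (\<Sum>j<h. \<alpha> j * G j x) = 0) \<longrightarrow> (\<forall>j<h. \<alpha> j = 0)) \<longrightarrow> m\<^sub>0 = h"
    using gram_schmidt_family[OF fin(1), of h G] by (elim exE conjE) (rule that)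
  have "m\<^sub>0 = h" using Uh indep by blast
  note u_orth = U(1)[unfolded \<open>m\<^sub>0 = h\<close>, rule_format] and u_span = U(2)[unfolded \<open>m\<^sub>0 = h\<close>, rule_format]
    and G_span = U(3)[unfolded \<open>m\<^sub>0 = h\<close>, rule_format]
  define ip where "ip f g = (\<Sum>a\<in>I. f a * g a)" for f g :: "'i \<Rightarrow> real"
  define pr where "pr v a = (\<Sum>i<h. ip v (u i) * u i a)" for v a
  have pr_comb: "\<exists>\<alpha>. pr v = comb \<alpha>" for v
  proof
    show "pr v = comb (\<lambda>k. \<Sum>i<h. ip v (u i) * c i k)"
      unfolding pr_def comb_def
      by (rule ext, simp add: u_span sum_distrib_left sum_distrib_right mult.assoc) (rule sum.swap)
  qed
  have nrm_pr: "nrm (pr v) = (\<Sum>i<h. (ip v (u i))\<^sup>2)" for v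
    using bessel_identity[OF u_orth, where f = "\<lambda>_. 0" and \<kappa> = "\<lambda>i. ip v (u i)"]
    by (simp add: nrm_def pr_def)
  have nrm_perp: "nrm (\<lambda>a. v a - pr v a) = nrm v - (\<Sum>i<h. (ip v (u i))\<^sup>2)" for v
    using bessel_identity[OF u_orth, where f = v and \<kappa> = "\<lambda>i. ip v (u i)"]
    by (simp add: nrm_def pr_def ip_def)
  have u_perp: "(\<Sum>a\<in>I. u i a * (v a - pr v a)) = 0" if "i < h" for i v
    using residual_orthogonal[OF u_orth that, of v] by (simp add: pr_def ip_def mult.commute)
  have G_perp: "(\<Sum>a\<in>I. G j a * (v a - pr v a)) = 0" if "j < h" for j v
  proof -
    have "(\<Sum>a\<in>I. G j a * (v a - pr v a)) = (\<Sum>a\<in>I. \<Sum>i<h. d j i * (u i a * (v a - pr v a)))"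
      using that by (intro sum.cong refl) (simp add: G_span sum_distrib_right mult.assoc)
    also have "\<dots> = (\<Sum>i<h. d j i * (\<Sum>a\<in>I. u i a * (v a - pr v a)))"
      by (subst sum.swap) (simp add: sum_distrib_left)
    also have "\<dots> = 0" by (simp add: u_perp)
    finally show ?thesis .
  qed
  have app_diff: "app F (\<lambda>a. v a - w a) t = app F v t - app F w t" for F v w t
    unfolding app_def by (simp add: left_diff_distrib sum_subtractf)
  have app_M0: "app M v t = (\<Sum>j<h. X j t * (\<Sum>a\<in>I. G j a * v a))" for v t
    unfolding app_def M sum_distrib_left by (subst sum.swap) (simp add: mult_ac)
  \<comment> \<open>M^T annihilates the orthogonal complement of the range of \<open>G\<close>, and
    E^T annihilates the range itself. Hence the bounds by \<open>\<sigma>\<close> extend to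
    arbitrary \<open>v\<close>, with the norm of its projection in \<open>lower\<close> and that of
    its remainder in \<open>upper\<close>.\<close>
  have app_M_pr: "app M (pr v) t = app M v t" for v t
    using app_diff[of M v "pr v" t] unfolding app_M0[of "\<lambda>a. v a - pr v a"] by (simp add: G_perp)
  have app_E_comb: "app E (comb \<alpha>) t = 0" if "t \<in> S" for \<alpha> t
  proof -
    have "app E (comb \<alpha>) t = (\<Sum>j<h. \<alpha> j * (\<Sum>a\<in>I. G j a * E a t))"
      unfolding app_def comb_def sum_distrib_left sum_distrib_right
      by (subst sum.swap) (simp add: mult.assoc)
    then show ?thesis using that by (simp add: GE)
  qed
  have upper: "sq (app E v) \<le> \<sigma> * (nrm v - (\<Sum>i<h. (ip v (u i))\<^sup>2))" for v
  proof -
    have "app E v t = app E (\<lambda>a. v a - pr v a) t" if "t \<in> S" for t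
      using app_E_comb[OF that] pr_comb[of v] unfolding app_diff by auto
    then have "sq (app E v) = sq (app E (\<lambda>a. v a - pr v a))"
      unfolding sq_def by (intro sum.cong refl) simp
    then show ?thesis using \<sigma>_upper[OF G_perp, of v] by (simp add: nrm_perp)
  qed
  have lower: "\<sigma> * (\<Sum>i<h. (ip v (u i))\<^sup>2) \<le> sq (app M v)" for v
  proof -
    have "sq (app M (pr v)) = sq (app M v)" unfolding sq_def app_M_pr ..
    then show ?thesis using \<sigma>_lower pr_comb[of v] nrm_pr[of v] by metis
  qed

  \<comment> \<open>Column space of the competitor\<close>
  obtain m v c' e where m: "m \<le> h"
    and Vf: "\<forall>i<m. \<forall>j<m. (\<Sum>x\<in>I. v i x * v j x) = of_bool (i = j)"
      "\<forall>i<m. \<forall>x. v i x = (\<Sum>j<h. c' i j * W j x)"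
      "\<forall>j<h. \<forall>x\<in>I. W j x = (\<Sum>i<m. e j i * v i x)"
    using gram_schmidt_family[OF fin(1), of h W] by (elim exE conjE) (rule that)
  note v_orth = Vf(1)[rule_format]
  define \<kappa> where "\<kappa> i t = (\<Sum>j<h. e j i * V j t)" for i t
  have K: "(\<Sum>j<h. W j a * V j t) = (\<Sum>i<m. \<kappa> i t * v i a)" if "a \<in> I" for a t
  proof -
    have "(\<Sum>j<h. W j a * V j t) = (\<Sum>j<h. \<Sum>i<m. e j i * V j t * v i a)"
      using that Vf(3) by (intro sum.cong refl) (simp add: sum_distrib_left sum_distrib_right mult_ac)
    then show ?thesis unfolding \<kappa>_def by (subst (asm) sum.swap) (simp add: sum_distrib_right)
  qed
  define N where "N a t = M a t + E a t" for a t
  \<comment> \<open>The best coefficients in the basis \<open>v\<close> are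
    \<open>app N (v i) t\<close>; any others add a nonnegative term.\<close>
  have fit: "(\<Sum>a\<in>I. (N a t)\<^sup>2) - (\<Sum>i<m. (app N (v i) t)\<^sup>2) \<le>
      (\<Sum>a\<in>I. (N a t - (\<Sum>j<h. W j a * V j t))\<^sup>2)" for t
  proof -
    have "(\<Sum>a\<in>I. (N a t - (\<Sum>j<h. W j a * V j t))\<^sup>2) = (\<Sum>a\<in>I. (N a t - (\<Sum>i<m. \<kappa> i t * v i a))\<^sup>2)"
      by (intro sum.cong refl) (simp add: K)
    also have "\<dots> = (\<Sum>a\<in>I. (N a t)\<^sup>2) - (\<Sum>i<m. (app N (v i) t)\<^sup>2)
        + (\<Sum>i<m. (\<kappa> i t - (\<Sum>x\<in>I. N x t * v i x))\<^sup>2)"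
      by (subst bessel_identity[OF v_orth]) (simp_all add: app_def mult.commute)
    finally show ?thesis by (simp add: sum_nonneg)
  qed
  have ME: "(\<Sum>a\<in>I. M a t * E a t) = 0" if "t \<in> S" for t
  proof -
    have "(\<Sum>a\<in>I. M a t * E a t) = (\<Sum>j<h. X j t * (\<Sum>a\<in>I. G j a * E a t))"
      unfolding M sum_distrib_left sum_distrib_right by (subst sum.swap) (simp add: mult_ac)
    then show ?thesis using that by (simp add: GE)
  qed
  have N_sq: "(\<Sum>a\<in>I. (N a t)\<^sup>2) = (\<Sum>a\<in>I. (M a t)\<^sup>2) + (\<Sum>a\<in>I. (E a t)\<^sup>2)" if "t \<in> S" for t
    using ME[OF that]
    by (simp add: N_def power2_sum sum.distrib mult.assoc sum_distrib_left[symmetric])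
  \<comment> \<open>M^T w is a combination of the \<open>X j\<close>, to which the rows of
    \<open>E\<close> are orthogonal, so the cross term vanishes.\<close>
  have app_N: "sq (app N w) = sq (app M w) + sq (app E w)" for w
  proof -
    have EX': "(\<Sum>t\<in>S. X j t * app E w t) = 0" if "j < h" for j
    proof -
      have "(\<Sum>t\<in>S. X j t * app E w t) = (\<Sum>a\<in>I. w a * (\<Sum>t\<in>S. E a t * X j t))"
        unfolding app_def sum_distrib_left by (subst sum.swap) (simp add: mult_ac)
      then show ?thesis using that by (simp add: EX)
    qed
    have "app M w t * app E w t = (\<Sum>j<h. (\<Sum>a\<in>I. G j a * w a) * (X j t * app E w t))" for t
      by (subst app_M0, subst sum_distrib_right) (simp only: mult_ac)
    then have "(\<Sum>t\<in>S. app M w t * app E w t) =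
        (\<Sum>j<h. (\<Sum>a\<in>I. G j a * w a) * (\<Sum>t\<in>S. X j t * app E w t))"
      by (simp only: sum_distrib_left) (rule sum.swap)
    also have "\<dots> = 0" by (simp add: EX')
    finally have cross: "(\<Sum>t\<in>S. app M w t * app E w t) = 0" .
    have "app N w t = app M w t + app E w t" for t
      unfolding app_def N_def by (simp add: distrib_left sum.distrib)
    then show ?thesis
      using cross by (simp add: sq_def power2_sum sum.distrib mult.assoc sum_distrib_left[symmetric])
  qed

  \<comment> \<open>The overlap of the two subspaces: the trace of the product of the projections
    onto the range of \<open>G\<close> and onto the span of the \<open>v i\<close>.\<close>
  define C where "C = (\<Sum>j<h. \<Sum>i<m. (ip (u j) (v i))\<^sup>2)"
  have C_alt: "(\<Sum>i<m. \<Sum>j<h. (ip (v i) (u j))\<^sup>2) = C"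
    unfolding C_def ip_def by (subst sum.swap) (simp add: mult.commute)
  have nrm_v: "nrm (v i) = 1" if "i < m" for i
    using v_orth[OF that that] by (simp add: nrm_def power2_eq_square)

  \<comment> \<open>Comparison of both traces with \<open>\<sigma> * (real h - C)\<close>\<close>
  have "(\<Sum>i<m. sq (app E (v i))) \<le> (\<Sum>i<m. \<sigma> * (1 - (\<Sum>j<h. (ip (v i) (u j))\<^sup>2)))"
    using upper[of "v _"] by (intro sum_mono) (metis lessThan_iff nrm_v)
  also have "\<dots> = \<sigma> * (real m - C)"
    by (simp add: sum_distrib_left[symmetric] sum_subtractf C_alt)
  \<comment> \<open>Here the rank bound \<open>m \<le> h\<close> enters, together with
    \<open>\<sigma> \<ge> 0\<close>.\<close>
  also have "\<dots> \<le> \<sigma> * (real h - C)"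
    using m \<sigma>0 by (intro mult_left_mono) auto
  finally have E_bound: "(\<Sum>i<m. sq (app E (v i))) \<le> \<sigma> * (real h - C)" .

  \<comment> \<open>\<open>w x\<close> is the coordinate vector at \<open>x\<close> projected onto
    the orthogonal complement of the \<open>v i\<close>. Summing a quadratic form over all
    \<open>w x\<close> gives its trace on that complement, so no basis of the complement has to be
    chosen.\<close>
  define w where "w x a = of_bool (a = x) - (\<Sum>i<m. v i x * v i a)" for x a
  have app_w: "app M (w x) t = M x t - (\<Sum>i<m. app M (v i) t * v i x)" if "x \<in> I" for x t
  proof -
    have "app M (w x) t = (\<Sum>a\<in>I. of_bool (a = x) * M a t) - (\<Sum>a\<in>I. \<Sum>i<m. v i a * M a t * v i x)"
      unfolding app_def w_def by (simp only: left_diff_distrib sum_subtractf sum_distrib_right) (simp only: mult_ac)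
    also have "(\<Sum>a\<in>I. of_bool (a = x) * M a t) = M x t"
      using that fin(1) by (simp add: of_bool_def if_distrib[where f = "\<lambda>c. c * q" for q] cong: if_cong)
    also have "(\<Sum>a\<in>I. \<Sum>i<m. v i a * M a t * v i x) = (\<Sum>i<m. app M (v i) t * v i x)"
      unfolding app_def by (subst sum.swap) (simp add: sum_distrib_right)
    finally show ?thesis .
  qed
  have ip_w: "ip (w x) (u j) = u j x - (\<Sum>i<m. ip (u j) (v i) * v i x)" if "x \<in> I" for x j
  proof -
    have "ip (w x) (u j) = (\<Sum>a\<in>I. of_bool (a = x) * u j a) - (\<Sum>a\<in>I. \<Sum>i<m. u j a * v i a * v i x)"
      unfolding ip_def w_def by (simp only: left_diff_distrib sum_subtractf sum_distrib_right) (simp only: mult_ac)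
    also have "(\<Sum>a\<in>I. of_bool (a = x) * u j a) = u j x"
      using that fin(1) by (simp add: of_bool_def if_distrib[where f = "\<lambda>c. c * q" for q] cong: if_cong)
    also have "(\<Sum>a\<in>I. \<Sum>i<m. u j a * v i a * v i x) = (\<Sum>i<m. ip (u j) (v i) * v i x)"
      unfolding ip_def by (subst sum.swap) (simp add: sum_distrib_right)
    finally show ?thesis .
  qed
  have u_trace: "(\<Sum>x\<in>I. (ip (w x) (u j))\<^sup>2) = 1 - (\<Sum>i<m. (ip (u j) (v i))\<^sup>2)" if "j < h" for j
  proof -
    have "(\<Sum>x\<in>I. (ip (w x) (u j))\<^sup>2) = (\<Sum>x\<in>I. (u j x - (\<Sum>i<m. ip (u j) (v i) * v i x))\<^sup>2)"
      by (intro sum.cong refl) (simp add: ip_w)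
    also have "\<dots> = (\<Sum>x\<in>I. (u j x)\<^sup>2) - (\<Sum>i<m. (ip (u j) (v i))\<^sup>2)"
      by (subst bessel_identity[OF v_orth]) (simp_all add: ip_def)
    finally show ?thesis using u_orth[OF that that] by (simp add: power2_eq_square)
  qed
  have M_trace: "(\<Sum>x\<in>I. sq (app M (w x))) = (\<Sum>t\<in>S. \<Sum>a\<in>I. (M a t)\<^sup>2) - (\<Sum>i<m. sq (app M (v i)))"
  proof -
    have "(\<Sum>x\<in>I. sq (app M (w x))) = (\<Sum>t\<in>S. \<Sum>x\<in>I. (M x t - (\<Sum>i<m. app M (v i) t * v i x))\<^sup>2)"
      unfolding sq_def by (subst sum.swap) (simp add: app_w)
    also have "\<dots> = (\<Sum>t\<in>S. (\<Sum>x\<in>I. (M x t)\<^sup>2) - (\<Sum>i<m. (app M (v i) t)\<^sup>2))"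
      by (intro sum.cong refl, subst bessel_identity[OF v_orth]) (simp_all add: app_def mult.commute)
    also have "\<dots> = (\<Sum>t\<in>S. \<Sum>a\<in>I. (M a t)\<^sup>2) - (\<Sum>i<m. sq (app M (v i)))"
      unfolding sq_def sum_subtractf by (subst (3) sum.swap) simp
    finally show ?thesis .
  qed
  \<comment> \<open>\<open>real h - C\<close> is what the complement of the \<open>v i\<close>
    retains of the basis \<open>u\<close>; the bound \<open>lower\<close> is then summed over the
    vectors \<open>w x\<close>.\<close>
  have "\<sigma> * (real h - C) = \<sigma> * (\<Sum>j<h. \<Sum>x\<in>I. (ip (w x) (u j))\<^sup>2)"
    by (simp add: u_trace sum_subtractf C_def)
  also have "\<dots> = (\<Sum>x\<in>I. \<sigma> * (\<Sum>j<h. (ip (w x) (u j))\<^sup>2))"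
    by (subst sum.swap) (simp add: sum_distrib_left)
  also have "\<dots> \<le> (\<Sum>x\<in>I. sq (app M (w x)))" by (intro sum_mono lower)
  finally have M_bound: "\<sigma> * (real h - C) \<le> (\<Sum>t\<in>S. \<Sum>a\<in>I. (M a t)\<^sup>2) - (\<Sum>i<m. sq (app M (v i)))"
    unfolding M_trace .
  \<comment> \<open>What the \<open>v i\<close> gain from \<open>E\<close> is at most
    \<open>\<sigma> * (real h - C)\<close>, and what they miss of \<open>M\<close> is at least that
    much.\<close>
  have "(\<Sum>i<m. sq (app N (v i))) \<le> (\<Sum>t\<in>S. \<Sum>a\<in>I. (M a t)\<^sup>2)"
    using E_bound M_bound by (simp add: app_N sum.distrib)
  then have "(\<Sum>t\<in>S. \<Sum>a\<in>I. (E a t)\<^sup>2) \<le>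
      (\<Sum>t\<in>S. \<Sum>a\<in>I. (N a t)\<^sup>2) - (\<Sum>i<m. sq (app N (v i)))"
    by (simp add: N_sq sum.distrib)
  also have "\<dots> = (\<Sum>t\<in>S. (\<Sum>a\<in>I. (N a t)\<^sup>2) - (\<Sum>i<m. (app N (v i) t)\<^sup>2))"
    unfolding sq_def sum_subtractf by (subst (3) sum.swap) simp
  also have "\<dots> \<le> (\<Sum>t\<in>S. \<Sum>a\<in>I. (N a t - (\<Sum>j<h. W j a * V j t))\<^sup>2)"
    by (intro sum_mono fit)
  finally show ?thesis unfolding N_def .
qed

text \<open>The hypotheses \<open>first\<close> and \<open>second\<close> are, up to constant
  factors, the first and second variation of the squared error in direction
  (\<open>D\<^sub>1\<close>, \<open>D\<^sub>2\<close>). Every fit lies in the span of the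
  \<open>z b\<close>, so the part of \<open>y\<close> orthogonal to that span adds the same constant
  to both errors, and the low-rank bound for the projected data suffices.\<close>

lemma second_order_imp_global_factorization:
  fixes y :: "'i \<Rightarrow> 't \<Rightarrow> real" and z :: "nat \<Rightarrow> 't \<Rightarrow> real"
    and G W :: "nat \<Rightarrow> 'i \<Rightarrow> real" and F V :: "nat \<Rightarrow> nat \<Rightarrow> real"
  assumes fin: "finite I" "finite S" and h: "h \<ge> 1"
    and X: "\<And>j t. X j t = (\<Sum>b<k. F j b * z b t)"
    and r: "\<And>a t. r a t = y a t - (\<Sum>j<h. G j a * X j t)"
    and first: "\<And>D\<^sub>1 D\<^sub>2. (\<Sum>t\<in>S. \<Sum>a\<in>I. r a t *
      (\<Sum>j<h. G j a * (\<Sum>b<k. D\<^sub>1 j b * z b t) + D\<^sub>2 j a * X j t)) = 0"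
    and second: "\<And>D\<^sub>1 D\<^sub>2. (\<Sum>t\<in>S. \<Sum>a\<in>I.
        (\<Sum>j<h. G j a * (\<Sum>b<k. D\<^sub>1 j b * z b t) + D\<^sub>2 j a * X j t)\<^sup>2 -
        2 * r a t * (\<Sum>j<h. D\<^sub>2 j a * (\<Sum>b<k. D\<^sub>1 j b * z b t))) \<ge> 0"
  shows "(\<Sum>t\<in>S. \<Sum>a\<in>I. (r a t)\<^sup>2) \<le>
    (\<Sum>t\<in>S. \<Sum>a\<in>I. (y a t - (\<Sum>j<h. W j a * (\<Sum>b<k. V j b * z b t)))\<^sup>2)"
proof -

  \<comment> \<open>Reduction to the projected data \<open>N\<close>\<close>
  define lc where "lc c t = (\<Sum>b<k. c b * z b t)" for c t
  define M where "M a t = (\<Sum>j<h. G j a * X j t)" for a t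
  have "\<exists>w. \<forall>b<k. (\<Sum>t\<in>S. (y a t - (\<Sum>b<k. w b * z b t)) * z b t) = 0" for a
    using least_squares_exists[OF fin(2), of k "y a" z] by blast
  then obtain w where w: "\<And>a b. b < k \<Longrightarrow> (\<Sum>t\<in>S. (y a t - (\<Sum>b<k. w a b * z b t)) * z b t) = 0"
    by metis
  define N where "N a = lc (w a)" for a
  \<comment> \<open>Coefficients of \<open>E\<close> with respect to \<open>z\<close>: they make
    \<open>E\<close> itself available as a direction for the first factor.\<close>
  define \<epsilon> where "\<epsilon> a b = w a b - (\<Sum>j<h. G j a * F j b)" for a b
  define E where "E a = lc (\<epsilon> a)" for a
  have lc_diff: "lc (\<lambda>b. c b - d b) t = lc c t - lc d t" for c d t
    unfolding lc_def by (simp add: left_diff_distrib sum_subtractf)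
  have lc_comb: "lc (\<lambda>b. \<Sum>i\<in>J. g i * c i b) t = (\<Sum>i\<in>J. g i * lc (c i) t)"
    for J :: "'j set" and g c t
    unfolding lc_def sum_distrib_left sum_distrib_right by (subst sum.swap) (simp add: mult.assoc)
  have N_M: "N a t = M a t + E a t" for a t
    unfolding N_def E_def \<epsilon>_def lc_diff lc_comb M_def X lc_def[symmetric] by simp
  have res: "(\<Sum>t\<in>S. (y a t - N a t) * lc c t) = 0" for a c
  proof -
    have "(\<Sum>t\<in>S. (y a t - N a t) * lc c t) = (\<Sum>b<k. c b * (\<Sum>t\<in>S. (y a t - N a t) * z b t))"
      unfolding lc_def[of c] sum_distrib_left by (subst sum.swap) (simp add: mult_ac)
    then show ?thesis using w unfolding N_def lc_def by simp
  qed
  have r_N: "r a t = (y a t - N a t) + E a t" for a t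
    unfolding r N_M M_def by simp
  \<comment> \<open>\<open>r\<close> and \<open>E\<close> differ by y - N, which is orthogonal to
    the span of the \<open>z b\<close>; so \<open>E\<close> may replace \<open>r\<close> in both
    variations.\<close>
  have rE: "(\<Sum>t\<in>S. r a t * lc c t) = (\<Sum>t\<in>S. E a t * lc c t)" for a c
    using res[of a c] unfolding r_N distrib_right sum.distrib by simp
  have rE2: "(\<Sum>t\<in>S. \<Sum>a\<in>I. r a t * lc (c a) t) = (\<Sum>t\<in>S. \<Sum>a\<in>I. E a t * lc (c a) t)" for c
    by (subst (1 2) sum.swap) (simp add: rE)
  have pyth: "(\<Sum>t\<in>S. (y a t - N a t + lc c t)\<^sup>2) = (\<Sum>t\<in>S. (y a t - N a t)\<^sup>2) + (\<Sum>t\<in>S. (lc c t)\<^sup>2)" for a c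
    using res[of a c] by (simp only: power2_sum sum.distrib mult.assoc sum_distrib_left[symmetric])
  have pyth2: "(\<Sum>t\<in>S. \<Sum>a\<in>I. (y a t - N a t + lc (c a) t)\<^sup>2) =
      (\<Sum>t\<in>S. \<Sum>a\<in>I. (y a t - N a t)\<^sup>2) + (\<Sum>t\<in>S. \<Sum>a\<in>I. (lc (c a) t)\<^sup>2)" for c
    by (subst (1 2 3) sum.swap) (simp add: pyth sum.distrib)

  have goal: ?thesis if bound: "(\<Sum>t\<in>S. \<Sum>a\<in>I. (E a t)\<^sup>2) \<le>
      (\<Sum>t\<in>S. \<Sum>a\<in>I. (M a t + E a t - (\<Sum>j<h. W j a * lc (V j) t))\<^sup>2)"
  proof -
    have K: "lc (\<lambda>b. w a b - (\<Sum>j<h. W j a * V j b)) t = M a t + E a t - (\<Sum>j<h. W j a * lc (V j) t)" for a t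
      unfolding lc_diff lc_comb N_def[symmetric] N_M ..
    have "(\<Sum>t\<in>S. \<Sum>a\<in>I. (r a t)\<^sup>2) = (\<Sum>t\<in>S. \<Sum>a\<in>I. (y a t - N a t)\<^sup>2) + (\<Sum>t\<in>S. \<Sum>a\<in>I. (E a t)\<^sup>2)"
      unfolding r_N E_def pyth2 ..
    also have "\<dots> \<le> (\<Sum>t\<in>S. \<Sum>a\<in>I. (y a t - N a t)\<^sup>2) +
        (\<Sum>t\<in>S. \<Sum>a\<in>I. (lc (\<lambda>b. w a b - (\<Sum>j<h. W j a * V j b)) t)\<^sup>2)"
      using bound unfolding K by simp
    also have "\<dots> = (\<Sum>t\<in>S. \<Sum>a\<in>I. (y a t - (\<Sum>j<h. W j a * lc (V j) t))\<^sup>2)"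
      by (subst pyth2[symmetric]) (simp add: K N_M)
    finally show ?thesis unfolding lc_def .
  qed

  \<comment> \<open>First- and second-order conditions in terms of \<open>E\<close>\<close>
  have GE: "(\<Sum>a\<in>I. G j a * E a t) = 0" if "j < h" "t \<in> S" for j t
  proof -
    \<comment> \<open>Vary only row \<open>j\<close> of the first factor, by the coefficients of row
      \<open>j\<close> of G^T E: the first variation becomes the squared norm of that row.\<close>
    define g where "g b = (\<Sum>a\<in>I. G j a * \<epsilon> a b)" for b
    have g: "lc g t = (\<Sum>a\<in>I. G j a * E a t)" for t
      unfolding g_def lc_comb E_def ..
    have *: "(\<Sum>i<h. G i a * (\<Sum>b<k. (if i = j then g b else 0) * z b t) + 0 * X i t) = lc (\<lambda>b. G j a * g b) t" for a t
    proof -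
      have "(\<Sum>i<h. G i a * (\<Sum>b<k. (if i = j then g b else 0) * z b t) + 0 * X i t) =
         (\<Sum>i<h. if i = j then G j a * lc g t else 0)"
        by (intro sum.cong refl) (auto simp: lc_def)
      then show ?thesis using that(1) by (simp add: lc_def sum_distrib_left mult.assoc)
    qed
    have "(\<Sum>t\<in>S. \<Sum>a\<in>I. E a t * lc (\<lambda>b. G j a * g b) t) = 0"
      using first[of "\<lambda>i b. if i = j then g b else 0" "\<lambda>_ _. 0"] unfolding * rE2 .
    also have "(\<lambda>t. \<Sum>a\<in>I. E a t * lc (\<lambda>b. G j a * g b) t) = (\<lambda>t. (lc g t)\<^sup>2)"
    proof
      fix t
      have "lc (\<lambda>b. G j a * g b) t = G j a * lc g t" for a
        by (simp add: lc_def sum_distrib_left mult.assoc)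
      then have "(\<Sum>a\<in>I. E a t * lc (\<lambda>b. G j a * g b) t) = (\<Sum>a\<in>I. E a t * (G j a * lc g t))"
        by simp
      also have "\<dots> = (\<Sum>a\<in>I. G j a * E a t) * lc g t"
        unfolding sum_distrib_right by (simp only: mult_ac)
      finally show "(\<Sum>a\<in>I. E a t * lc (\<lambda>b. G j a * g b) t) = (lc g t)\<^sup>2"
        by (simp only: g[symmetric] power2_eq_square)
    qed
    finally have "lc g t = 0"
      using fin(2) that(2) by (subst (asm) sum_nonneg_eq_0_iff) auto
    then show ?thesis unfolding g .
  qed
  have EX: "(\<Sum>t\<in>S. E a t * X j t) = 0" if "j < h" "a \<in> I" for j a
  proof -
    have X_lc: "X j = lc (F j)" unfolding lc_def X by (rule ext) simp
    \<comment> \<open>Vary only the entry of the second factor at row \<open>a\<close> and column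
      \<open>j\<close>.\<close>
    have "(\<Sum>i<h. G i a' * (\<Sum>b<k. 0 * z b t) + of_bool (i = j \<and> a' = a) * X i t) =
        (\<Sum>i<h. if i = j then of_bool (a' = a) * X j t else 0)" for a' t
      by (intro sum.cong refl) auto
    then have *: "(\<Sum>i<h. G i a' * (\<Sum>b<k. 0 * z b t) + of_bool (i = j \<and> a' = a) * X i t) =
        of_bool (a' = a) * X j t" for a' t
      using that by simp
    have "0 = (\<Sum>t\<in>S. \<Sum>a'\<in>I. r a' t * (of_bool (a' = a) * X j t))"
      using first[of "\<lambda>_ _. 0" "\<lambda>i a'. of_bool (i = j \<and> a' = a)"] unfolding * ..
    also have "\<dots> = (\<Sum>t\<in>S. \<Sum>a'\<in>I. if a' = a then r a t * X j t else 0)"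
      by (intro sum.cong refl) auto
    also have "\<dots> = (\<Sum>t\<in>S. r a t * X j t)" using that fin(1) by simp
    finally show ?thesis unfolding X_lc rE by simp
  qed
  \<comment> \<open>The second variation along the outer products of \<alpha> with \<open>c\<close>
    in the first factor and of \<open>e\<close> with \<beta> in the second. Their product carries
    the inner product of \<alpha> and \<beta> as a factor.\<close>
  have rank_one: "2 * (\<Sum>j<h. \<alpha> j * \<beta> j) * (\<Sum>t\<in>S. \<Sum>a\<in>I. E a t * (e a * lc c t)) \<le>
      (\<Sum>t\<in>S. \<Sum>a\<in>I. ((\<Sum>j<h. \<alpha> j * G j a) * lc c t + e a * (\<Sum>j<h. \<beta> j * X j t))\<^sup>2)"
    for \<alpha> \<beta> e c
  proof -
    have s: "(\<Sum>b<k. \<alpha> j * c b * z b t) = \<alpha> j * lc c t" for j t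
      by (simp add: lc_def sum_distrib_left mult.assoc)
    have 1: "(\<Sum>j<h. G j a * (\<Sum>b<k. \<alpha> j * c b * z b t) + \<beta> j * e a * X j t) =
        (\<Sum>j<h. \<alpha> j * G j a) * lc c t + e a * (\<Sum>j<h. \<beta> j * X j t)" for a t
      unfolding s by (simp add: sum.distrib sum_distrib_left sum_distrib_right mult_ac)
    have 2: "lc (\<lambda>b. e a * c b) t = e a * lc c t" for a t
      by (simp add: lc_def sum_distrib_left mult.assoc)
    have 3: "2 * r a t * (\<Sum>j<h. \<beta> j * e a * (\<Sum>b<k. \<alpha> j * c b * z b t)) =
        2 * (\<Sum>j<h. \<alpha> j * \<beta> j) * (r a t * lc (\<lambda>b. e a * c b) t)" for a t
      unfolding s 2 by (simp add: sum_distrib_left sum_distrib_right mult_ac)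
    have 4: "(\<Sum>t\<in>S. \<Sum>a\<in>I. K * f a t) = K * (\<Sum>t\<in>S. \<Sum>a\<in>I. f a t)" for K and f :: "'i \<Rightarrow> 't \<Rightarrow> real"
      by (simp only: sum_distrib_left)
    have "0 \<le> (\<Sum>t\<in>S. \<Sum>a\<in>I. ((\<Sum>j<h. \<alpha> j * G j a) * lc c t + e a * (\<Sum>j<h. \<beta> j * X j t))\<^sup>2)
        - 2 * (\<Sum>j<h. \<alpha> j * \<beta> j) * (\<Sum>t\<in>S. \<Sum>a\<in>I. r a t * lc (\<lambda>b. e a * c b) t)"
      using second[of "\<lambda>j b. \<alpha> j * c b" "\<lambda>j a. \<beta> j * e a"]
      by (simp only: 1 3 4 sum_subtractf)
    then show ?thesis unfolding rE2 unfolding 2 by simp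
  qed

  \<comment> \<open>Rank-deficient and full-rank second factor\<close>
  show ?thesis
  proof (cases "\<forall>\<alpha>. (\<forall>a\<in>I. (\<Sum>j<h. \<alpha> j * G j a) = 0) \<longrightarrow> (\<forall>j<h. \<alpha> j = 0)")
    case False
    then obtain \<alpha> j where \<alpha>: "\<And>a. a \<in> I \<Longrightarrow> (\<Sum>j<h. \<alpha> j * G j a) = 0" and j: "j < h" "\<alpha> j \<noteq> 0"
      by blast
    have pos: "(\<Sum>j<h. \<alpha> j * \<alpha> j) > 0"
      using j by (intro sum_pos2[of _ j]) (auto simp: zero_less_mult_iff)
    have "E a t = 0" if "a \<in> I" "t \<in> S" for a t
    proof -
      define Q where "Q = (\<Sum>t\<in>S. (E a t)\<^sup>2)"
      define e :: "'i \<Rightarrow> real" where "e a' = of_bool (a' = a)" for a'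
      define B where "B = (\<Sum>t\<in>S. \<Sum>a\<in>I. (e a * (\<Sum>j<h. \<alpha> j * X j t))\<^sup>2)"
      \<comment> \<open>Scaling the kernel vector \<alpha> by \<open>s\<close> in the first factor
        leaves the right-hand side of \<open>rank_one\<close> unchanged, while the left-hand side is
        linear in \<open>s\<close>. This is compatible with all \<open>s\<close> only if
        \<open>Q = 0\<close>.\<close>
      have le_B: "2 * (s * (\<Sum>j<h. \<alpha> j * \<alpha> j)) * Q \<le> B" for s
      proof -
        have "(\<Sum>t\<in>S. \<Sum>a'\<in>I. E a' t * (e a' * lc (\<epsilon> a) t)) = (\<Sum>t\<in>S. \<Sum>a'\<in>I. if a' = a then (E a t)\<^sup>2 else 0)"
          by (intro sum.cong refl) (auto simp: e_def E_def power2_eq_square)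
        then have 1: "(\<Sum>t\<in>S. \<Sum>a'\<in>I. E a' t * (e a' * lc (\<epsilon> a) t)) = Q"
          using that fin(1) by (simp add: Q_def)
        have 2: "(\<Sum>j<h. s * \<alpha> j * G j a) = 0" if "a \<in> I" for a
          using \<alpha>[OF that] by (simp add: mult.assoc sum_distrib_left[symmetric])
        have 3: "(\<Sum>t\<in>S. \<Sum>a'\<in>I. ((\<Sum>j<h. s * \<alpha> j * G j a') * lc (\<epsilon> a) t + e a' * (\<Sum>j<h. \<alpha> j * X j t))\<^sup>2) = B"
          unfolding B_def by (intro sum.cong refl) (simp only: 2 mult_zero_left add_0_left)
        have 4: "(\<Sum>j<h. s * \<alpha> j * \<alpha> j) = s * (\<Sum>j<h. \<alpha> j * \<alpha> j)"
          by (simp add: sum_distrib_left mult.assoc)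
        show ?thesis
          using rank_one[of "\<lambda>j. s * \<alpha> j" \<alpha> e "\<epsilon> a"] unfolding 1 3 4 .
      qed
      have "Q \<ge> 0" unfolding Q_def by (auto intro!: sum_nonneg)
      have "Q = 0"
      proof (rule ccontr)
        assume "Q \<noteq> 0"
        with \<open>Q \<ge> 0\<close> have "Q > 0" by simp
        \<comment> \<open>This value of \<open>s\<close> makes the left-hand side of
          \<open>le_B\<close> equal to \<open>B + 1\<close>.\<close>
        have "2 * ((B + 1) / (2 * (\<Sum>j<h. \<alpha> j * \<alpha> j)) / Q * (\<Sum>j<h. \<alpha> j * \<alpha> j)) * Q = B + 1"
          using pos \<open>Q > 0\<close> by simp
        then show False
          using le_B[of "(B + 1) / (2 * (\<Sum>j<h. \<alpha> j * \<alpha> j)) / Q"] by simp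
      qed
      then show ?thesis using that fin(2) unfolding Q_def by (subst (asm) sum_nonneg_eq_0_iff) auto
    qed
    then show ?thesis by (intro goal) (simp add: sum_nonneg)
  next
    case True
    have "(\<Sum>t\<in>S. \<Sum>a\<in>I. (E a t)\<^sup>2) \<le>
      (\<Sum>t\<in>S. \<Sum>a\<in>I. (M a t + E a t - (\<Sum>j<h. W j a * lc (V j) t))\<^sup>2)"
    proof (rule low_rank_error_bound[OF fin h M_def GE EX])
      fix \<alpha> :: "nat \<Rightarrow> real" assume "\<forall>a\<in>I. (\<Sum>j<h. \<alpha> j * G j a) = 0"
      with True show "\<forall>j<h. \<alpha> j = 0" by blast
    next
      fix \<alpha> v assume v: "\<And>j. j < h \<Longrightarrow> (\<Sum>a\<in>I. G j a * v a) = 0"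
      define u where "u a = (\<Sum>j<h. \<alpha> j * G j a)" for a
      \<comment> \<open>With u = G \<alpha> and \<beta> = G^T u, the inner product of \<alpha> and
        \<beta> is the squared norm of \<open>u\<close>, and \<beta> applied to \<open>X\<close>
        gives M^T u. Taking \<open>e = v\<close> and \<open>c\<close> as the coefficients of E^T v,
        orthogonality of \<open>u\<close> and \<open>v\<close> removes the cross term on the right.
        Half of the left-hand side then cancels, which leaves \<open>gap\<close>.\<close>
      define \<beta> where "\<beta> j = (\<Sum>a\<in>I. u a * G j a)" for j
      define c where "c b = (\<Sum>a\<in>I. v a * \<epsilon> a b)" for b
      define \<xi> where "\<xi> t = (\<Sum>a\<in>I. v a * E a t)" for t
      define \<mu> where "\<mu> t = (\<Sum>a\<in>I. u a * M a t)" for t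
      have \<xi>: "lc c t = \<xi> t" for t unfolding c_def lc_comb E_def \<xi>_def ..
      have \<mu>: "(\<Sum>j<h. \<beta> j * X j t) = \<mu> t" for t
        unfolding \<beta>_def \<mu>_def M_def sum_distrib_left sum_distrib_right
        by (subst sum.swap) (simp add: mult_ac)
      have \<alpha>\<beta>: "(\<Sum>j<h. \<alpha> j * \<beta> j) = (\<Sum>a\<in>I. (u a)\<^sup>2)"
      proof -
        have "(\<Sum>j<h. \<alpha> j * \<beta> j) = (\<Sum>a\<in>I. \<Sum>j<h. u a * (\<alpha> j * G j a))"
          unfolding \<beta>_def sum_distrib_left by (subst sum.swap) (simp add: mult_ac)
        then show ?thesis by (simp add: sum_distrib_left[symmetric] u_def[symmetric] power2_eq_square)
      qed
      have uv: "(\<Sum>a\<in>I. u a * v a) = 0"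
      proof -
        have "(\<Sum>a\<in>I. u a * v a) = (\<Sum>j<h. \<alpha> j * (\<Sum>a\<in>I. G j a * v a))"
          unfolding u_def sum_distrib_left sum_distrib_right by (subst sum.swap) (simp add: mult_ac)
        then show ?thesis by (simp add: v)
      qed
      have T: "(\<Sum>a\<in>I. E a t * (v a * \<xi> t)) = (\<xi> t)\<^sup>2" for t
        by (subst power2_eq_square, subst (2) \<xi>_def, subst sum_distrib_left) (simp only: mult_ac)
      have Sq: "(\<Sum>a\<in>I. (u a * \<xi> t + v a * \<mu> t)\<^sup>2) =
          (\<Sum>a\<in>I. (u a)\<^sup>2) * (\<xi> t)\<^sup>2 + (\<Sum>a\<in>I. (v a)\<^sup>2) * (\<mu> t)\<^sup>2" for t
      proof -
        have "(\<Sum>a\<in>I. (u a * \<xi> t + v a * \<mu> t)\<^sup>2) =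
          (\<Sum>a\<in>I. (u a)\<^sup>2) * (\<xi> t)\<^sup>2 + (\<Sum>a\<in>I. (v a)\<^sup>2) * (\<mu> t)\<^sup>2 + 2 * \<xi> t * \<mu> t * (\<Sum>a\<in>I. u a * v a)"
          by (simp add: power2_sum power_mult_distrib sum.distrib sum_distrib_left sum_distrib_right mult_ac)
        then show ?thesis unfolding uv by simp
      qed
      show "(\<Sum>a\<in>I. (\<Sum>j<h. \<alpha> j * G j a)\<^sup>2) * (\<Sum>t\<in>S. (\<Sum>a\<in>I. v a * E a t)\<^sup>2) \<le>
          (\<Sum>a\<in>I. (v a)\<^sup>2) * (\<Sum>t\<in>S. (\<Sum>a\<in>I. (\<Sum>j<h. \<alpha> j * G j a) * M a t)\<^sup>2)"
        using rank_one[of \<alpha> \<beta> v c]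
        unfolding \<xi> \<mu> \<alpha>\<beta> T u_def[symmetric] Sq sum.distrib sum_distrib_left[symmetric]
          \<xi>_def[symmetric] \<mu>_def[symmetric] by simp
    qed
    then show ?thesis by (rule goal)
  qed
qed

subsection \<open>Positive semidefinite matrices\<close>

lemma scalar_prod_self_nonneg: "scalar_prod x x \<ge> (0 :: real)"
  by (simp add: scalar_prod_def sum_nonneg)

lemma mult_mat_vec_bounded:
  fixes A :: "real mat"
  assumes A: "A \<in> carrier_mat n k"
  obtains c where "c > 0" "\<And>x. x \<in> carrier_vec k \<Longrightarrow> scalar_prod (A *\<^sub>v x) (A *\<^sub>v x) \<le> c * scalar_prod x x"
proof
  \<comment> \<open>The sum is the squared Frobenius norm; the added 1 keeps the constant positive
    for a zero matrix.\<close>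
  let ?c = "1 + (\<Sum>i<n. scalar_prod (row A i) (row A i))"
  show "?c > 0" by (simp add: add_pos_nonneg sum_nonneg scalar_prod_self_nonneg)
  fix x :: "real vec" assume x: "x \<in> carrier_vec k"
  have "scalar_prod (A *\<^sub>v x) (A *\<^sub>v x) = (\<Sum>i<n. (scalar_prod (row A i) x)\<^sup>2)"
    using A by (simp add: scalar_prod_def[of "A *\<^sub>v x"] power2_eq_square lessThan_atLeast0)
  also have "\<dots> \<le> (\<Sum>i<n. scalar_prod (row A i) (row A i) * scalar_prod x x)"
  proof (rule sum_mono)
    fix i
    show "(scalar_prod (row A i) x)\<^sup>2 \<le> scalar_prod (row A i) (row A i) * scalar_prod x x"
      using Cauchy_Schwarz_ineq_sum[of "\<lambda>j. row A i $ j" "\<lambda>j. x $ j" "{0..<k}"] x A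
      by (simp add: scalar_prod_def power2_eq_square)
  qed
  also have "\<dots> \<le> ?c * scalar_prod x x"
    by (simp add: sum_distrib_right[symmetric] distrib_right scalar_prod_self_nonneg)
  finally show "scalar_prod (A *\<^sub>v x) (A *\<^sub>v x) \<le> ?c * scalar_prod x x" .
qed

lemma scalar_prod_add_self:
  fixes x y :: "real vec"
  assumes "x \<in> carrier_vec n" "y \<in> carrier_vec n"
  shows "scalar_prod (x + s \<cdot>\<^sub>v y) (x + s \<cdot>\<^sub>v y) = scalar_prod x x + 2 * s * scalar_prod x y + s\<^sup>2 * scalar_prod y y"
proof -
  have "scalar_prod (x + s \<cdot>\<^sub>v y) (x + s \<cdot>\<^sub>v y) =
      (\<Sum>i<n. x $ i * x $ i + 2 * s * (x $ i * y $ i) + s\<^sup>2 * (y $ i * y $ i))"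
    using assms unfolding scalar_prod_def lessThan_atLeast0
    by (intro sum.cong) (auto simp: power2_eq_square algebra_simps)
  also have "\<dots> = scalar_prod x x + 2 * s * scalar_prod x y + s\<^sup>2 * scalar_prod y y"
    using assms by (simp only: scalar_prod_def sum.distrib sum_distrib_left lessThan_atLeast0 carrier_vecD)
  finally show ?thesis .
qed

text \<open>Since the squared norms of x + A x and x - A x are nonnegative, twice the absolute value
  of the form is at most the sum of the squared norms of x and A x.\<close>

lemma quadratic_form_bounded:
  fixes A :: "real mat"
  assumes A: "A \<in> carrier_mat n n"
  obtains c where "c > 0" "\<And>x. x \<in> carrier_vec n \<Longrightarrow> \<bar>scalar_prod x (A *\<^sub>v x)\<bar> \<le> c * scalar_prod x x"
proof -
  obtain c where c: "c > 0"
    "\<And>x. x \<in> carrier_vec n \<Longrightarrow> scalar_prod (A *\<^sub>v x) (A *\<^sub>v x) \<le> c * scalar_prod x x"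
    using mult_mat_vec_bounded[OF A] by blast
  have "\<bar>scalar_prod x (A *\<^sub>v x)\<bar> \<le> (1 + c) * scalar_prod x x" if x: "x \<in> carrier_vec n" for x
  proof -
    have Ax: "A *\<^sub>v x \<in> carrier_vec n" using A x by simp
    have "0 \<le> scalar_prod x x + 2 * s * scalar_prod x (A *\<^sub>v x) + s\<^sup>2 * scalar_prod (A *\<^sub>v x) (A *\<^sub>v x)" for s
      using scalar_prod_self_nonneg[of "x + s \<cdot>\<^sub>v (A *\<^sub>v x)"] unfolding scalar_prod_add_self[OF x Ax] .
    from this[of 1] this[of "-1"] c(2)[OF x] scalar_prod_self_nonneg[of x] scalar_prod_self_nonneg[of "A *\<^sub>v x"]
    have "2 * \<bar>scalar_prod x (A *\<^sub>v x)\<bar> \<le> scalar_prod x x + c * scalar_prod x x" by simp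
    then show ?thesis using scalar_prod_self_nonneg[of x] mult_nonneg_nonneg[of c "scalar_prod x x"] c(1)
      by (simp add: distrib_right)
  qed
  then show ?thesis using c(1) by (intro that[of "1 + c"]) auto
qed

text \<open>With \<open>P\<close> positive semidefinite and \<open>w = P x\<close>, expanding \<open>(x - s w) \<bullet> P (x - s w) \<ge> 0\<close> at
  \<open>s = 1 / c\<close> bounds \<open>x \<bullet> P x\<close> below by \<open>\<parallel>P x\<parallel>\<^sup>2 / c\<close>.\<close>

lemma psd_nonsingular_coercive:
  fixes P :: "real mat"
  assumes P: "P \<in> carrier_mat n n" "P\<^sup>T = P" and det: "det P \<noteq> 0"
    and psd: "\<And>x. x \<in> carrier_vec n \<Longrightarrow> scalar_prod x (P *\<^sub>v x) \<ge> 0"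
  obtains e where "e > 0" "\<And>x. x \<in> carrier_vec n \<Longrightarrow> scalar_prod x (P *\<^sub>v x) \<ge> e * scalar_prod x x"
proof -
  obtain Q where Q: "Q \<in> carrier_mat n n" "Q * P = 1\<^sub>m n"
    using det_non_zero_imp_unit[OF P(1) det, of "()"] by (auto simp: Units_def ring_mat_simps)
  obtain a where a: "a > 0" "\<And>x. x \<in> carrier_vec n \<Longrightarrow> scalar_prod (Q *\<^sub>v x) (Q *\<^sub>v x) \<le> a * scalar_prod x x"
    using mult_mat_vec_bounded[OF Q(1)] by blast
  obtain c where c: "c > 0" "\<And>x. x \<in> carrier_vec n \<Longrightarrow> \<bar>scalar_prod x (P *\<^sub>v x)\<bar> \<le> c * scalar_prod x x"
    using quadratic_form_bounded[OF P(1)] by blast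
  \<comment> \<open>The bound \<open>a\<close> on the inverse \<open>Q\<close> controls the norm of
    \<open>x\<close> by that of \<open>P x\<close>, so a lower bound in terms of \<open>P x\<close>
    becomes coercivity.\<close>
  have "1 / (a * c) * scalar_prod x x \<le> scalar_prod x (P *\<^sub>v x)" if x: "x \<in> carrier_vec n" for x
  proof -
    define w where "w = P *\<^sub>v x"
    have w: "w \<in> carrier_vec n" using P x by (simp add: w_def)
    have "Q *\<^sub>v w = x" unfolding w_def using Q P x by (simp add: assoc_mult_mat_vec[symmetric])
    then have xw: "scalar_prod x x \<le> a * scalar_prod w w" using a(2)[OF w] by simp
    have Pw: "P *\<^sub>v w \<in> carrier_vec n" using P w by simp
    have sym: "scalar_prod x (P *\<^sub>v w) = scalar_prod w w"
      unfolding w_def[symmetric]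
      using transpose_vec_mult_scalar[OF P(1), of w x] P(2) w x by (simp add: w_def)
    let ?v = "x + (- 1 / c) \<cdot>\<^sub>v w"
    have Pv: "P *\<^sub>v ?v = w + (- 1 / c) \<cdot>\<^sub>v (P *\<^sub>v w)"
      using P x w by (simp add: mult_add_distrib_mat_vec[OF P(1)] mult_mat_vec[OF P(1)] w_def)
    have "scalar_prod ?v (P *\<^sub>v ?v) = scalar_prod x w + (- 1 / c) * scalar_prod x (P *\<^sub>v w)
        + (- 1 / c) * scalar_prod w w + (1 / c)\<^sup>2 * scalar_prod w (P *\<^sub>v w)"
      unfolding Pv using x w Pw
      by (simp add: add_scalar_prod_distrib[of _ n] scalar_prod_add_distrib[of _ n] power2_eq_square)
    moreover have "scalar_prod ?v (P *\<^sub>v ?v) \<ge> 0" using psd x w by simp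
    moreover have "(1 / c)\<^sup>2 * scalar_prod w (P *\<^sub>v w) \<le> (1 / c)\<^sup>2 * (c * scalar_prod w w)"
      using c(2)[OF w] by (intro mult_left_mono) auto
    moreover have "(1 / c)\<^sup>2 * (c * scalar_prod w w) = scalar_prod w w / c"
      using c(1) by (simp add: power2_eq_square)
    moreover have "(- 1 / c) * scalar_prod w w = - (scalar_prod w w / c)" by simp
    ultimately have "scalar_prod w w / c \<le> scalar_prod x w"
      unfolding sym by linarith
    moreover have "1 / (a * c) * scalar_prod x x \<le> scalar_prod w w / c"
      using xw a(1) c(1) by (simp add: field_simps)
    ultimately show ?thesis by (simp add: w_def)
  qed
  then show ?thesis using a(1) c(1) by (intro that[of "1 / (a * c)"]) auto
qed

text \<open>Shift \<open>H\<close> by the least \<open>t \<ge> 0\<close> that makes it positive semidefinite. If \<open>t > 0\<close>, then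
  \<open>- t\<close> is not an eigenvalue, so the shifted matrix is coercive and a smaller shift would do.\<close>

lemma symmetric_eigenvalues_nonneg_imp_psd:
  fixes H :: "real mat"
  assumes H: "H \<in> carrier_mat n n" "H\<^sup>T = H" and eig: "\<And>k. eigenvalue H k \<Longrightarrow> k \<ge> 0"
  shows "pos_semidef n H"
proof -
  define B where "B = {t. t \<ge> 0 \<and> (\<forall>x\<in>carrier_vec n. scalar_prod x (H *\<^sub>v x) + t * scalar_prod x x \<ge> 0)}"
  obtain c where c: "c > 0" "\<And>x. x \<in> carrier_vec n \<Longrightarrow> \<bar>scalar_prod x (H *\<^sub>v x)\<bar> \<le> c * scalar_prod x x"
    using quadratic_form_bounded[OF H(1)] by blast
  have "c \<in> B" unfolding B_def using c by (force simp: abs_le_iff)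
  then have ne: "B \<noteq> {}" by blast
  have bdd: "bdd_below B" unfolding B_def by (rule bdd_belowI[of _ 0]) auto
  define t where "t = Inf B"
  have t0: "t \<ge> 0" unfolding t_def by (rule cInf_greatest[OF ne]) (auto simp: B_def)
  \<comment> \<open>The infimum is attained: each nonzero \<open>x\<close> bounds all of
    \<open>B\<close> from below by the negative of its Rayleigh quotient.\<close>
  have t: "scalar_prod x (H *\<^sub>v x) + t * scalar_prod x x \<ge> 0" if x: "x \<in> carrier_vec n" for x
  proof (cases "scalar_prod x x = 0")
    case True
    then show ?thesis using c(2)[OF x] by simp
  next
    case False
    then have pos: "scalar_prod x x > 0" using scalar_prod_self_nonneg[of x] by simp
    have "- scalar_prod x (H *\<^sub>v x) / scalar_prod x x \<le> t"
      unfolding t_def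
    proof (rule cInf_greatest[OF ne])
      fix s assume "s \<in> B"
      then have "scalar_prod x (H *\<^sub>v x) + s * scalar_prod x x \<ge> 0" using x by (simp add: B_def)
      then show "- scalar_prod x (H *\<^sub>v x) / scalar_prod x x \<le> s"
        unfolding pos_divide_le_eq[OF pos] by linarith
    qed
    then show ?thesis unfolding pos_divide_le_eq[OF pos] by linarith
  qed
  have "t = 0"
  proof (rule ccontr)
    assume "t \<noteq> 0"
    with t0 have tpos: "t > 0" by simp
    \<comment> \<open>\<open>char_matrix H (- t)\<close> is H + t I.\<close>
    define P where "P = char_matrix H (- t)"
    have P: "P \<in> carrier_mat n n" using H by (simp add: P_def)
    have "(t \<cdot>\<^sub>m 1\<^sub>m n)\<^sup>T = t \<cdot>\<^sub>m 1\<^sub>m n" by (intro eq_matI) auto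
    then have PT: "P\<^sup>T = P"
      unfolding P_def char_matrix_def using H by (simp add: transpose_add[of _ n n])
    have Pv: "scalar_prod x (P *\<^sub>v x) = scalar_prod x (H *\<^sub>v x) + t * scalar_prod x x"
      if x: "x \<in> carrier_vec n" for x
    proof -
      have "(t \<cdot>\<^sub>m 1\<^sub>m n) *\<^sub>v x = t \<cdot>\<^sub>v x" using x by (intro eq_vecI) auto
      then show ?thesis
        unfolding P_def char_matrix_def using H x
        by (simp add: add_mult_distrib_mat_vec[of _ n n] scalar_prod_add_distrib[of _ n])
    qed
    have "\<not> eigenvalue H (- t)" using eig tpos by force
    then have "det P \<noteq> 0" unfolding P_def eigenvalue_det[OF H(1)] .
    then obtain e where e: "e > 0" "\<And>x. x \<in> carrier_vec n \<Longrightarrow> scalar_prod x (P *\<^sub>v x) \<ge> e * scalar_prod x x"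
      using psd_nonsingular_coercive[OF P PT] t Pv by auto
    \<comment> \<open>The maximum with 0 respects the sign condition in \<open>B\<close>; since
      \<open>t\<close> and \<open>e\<close> are positive, \<open>s\<close> is still smaller than
      \<open>t\<close>.\<close>
    define s where "s = max 0 (t - e)"
    have "s \<in> B"
      unfolding B_def
    proof (intro CollectI conjI ballI)
      show "s \<ge> 0" by (simp add: s_def)
      fix x :: "real vec" assume x: "x \<in> carrier_vec n"
      have "(t - e) * scalar_prod x x \<le> s * scalar_prod x x"
        by (intro mult_right_mono scalar_prod_self_nonneg) (simp add: s_def)
      then show "scalar_prod x (H *\<^sub>v x) + s * scalar_prod x x \<ge> 0"
        using e(2)[OF x] Pv[OF x] by (simp add: left_diff_distrib)
    qed
    then have "t \<le> s" unfolding t_def by (rule cInf_lower[OF _ bdd])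
    then show False using tpos e(1) by (simp add: s_def)
  qed
  then show ?thesis unfolding pos_semidef_def using H t by auto
qed

lemma lambda_min_nonneg_imp_psd:
  assumes H: "H \<in> carrier_mat n n" "H\<^sup>T = H" and "lambda_min H \<ge> 0"
  shows "pos_semidef n H"
proof (rule symmetric_eigenvalues_nonneg_imp_psd[OF H])
  fix k assume "eigenvalue H k"
  moreover have "finite {k. eigenvalue H k}"
    using spectrum_def[of H] card_finite_spectrum(1)[OF H(1)] by simp
  ultimately have "lambda_min H \<le> k" unfolding lambda_min_def by (intro Min_le) auto
  with assms(3) show "k \<ge> 0" by simp
qed

subsection \<open>Gradient and Hessian of a sum of squares of quadratic functions\<close>

text \<open>\<open>q \<tau>\<close> is a homogeneous quadratic form and \<open>l \<tau>\<close> its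
  polar form. The axioms ask only for expansions along lines, which is all that a partial derivative
  sees; linearity in the second argument follows through \<open>l_sym\<close>.\<close>

locale quadratic_residuals =
  fixes d :: nat and I :: "'i set" and q :: "'i \<Rightarrow> real vec \<Rightarrow> real"
    and l :: "'i \<Rightarrow> real vec \<Rightarrow> real vec \<Rightarrow> real" and f :: "real vec \<Rightarrow> real"
    and c :: real and y :: "'i \<Rightarrow> real"
  assumes q_line: "\<And>\<tau> X D s. X \<in> carrier_vec d \<Longrightarrow> D \<in> carrier_vec d \<Longrightarrow>
      q \<tau> (X + s \<cdot>\<^sub>v D) = q \<tau> X + s * l \<tau> X D + s\<^sup>2 * q \<tau> D"
    and l_line: "\<And>\<tau> X D E s. X \<in> carrier_vec d \<Longrightarrow> D \<in> carrier_vec d \<Longrightarrow> E \<in> carrier_vec d \<Longrightarrow>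
      l \<tau> (X + s \<cdot>\<^sub>v D) E = l \<tau> X E + s * l \<tau> D E"
    and l_sym: "\<And>\<tau> X D. l \<tau> X D = l \<tau> D X"
    and l_diag: "\<And>\<tau> D. l \<tau> D D = 2 * q \<tau> D"
    and f: "\<And>X. f X = c * (\<Sum>\<tau>\<in>I. (y \<tau> - q \<tau> X)\<^sup>2)"
begin

lemma l_unit_vec_expansion:
  assumes X: "X \<in> carrier_vec d" and D: "D \<in> carrier_vec d"
  shows "l \<tau> X D = (\<Sum>i<d. D $ i * l \<tau> X (unit_vec d i))"
proof -
  \<comment> \<open>Truncations of \<open>D\<close>: each differs from its predecessor by a multiple
    of one unit vector, so \<open>l_line\<close> suffices for the induction.\<close>
  define R where "R n = vec d (\<lambda>i. if i < n then D $ i else 0)" for n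
  have R: "R n \<in> carrier_vec d" for n by (simp add: R_def)
  have "l \<tau> X (R n) = (\<Sum>i<n. D $ i * l \<tau> X (unit_vec d i))" if "n \<le> d" for n
    using that
  proof (induction n)
    case 0
    \<comment> \<open>\<open>R 0\<close> is the zero vector; expanding along R 0 + 1 R 0 forces the
      value of \<open>l\<close> there to be 0.\<close>
    have "R 0 = R 0 + 1 \<cdot>\<^sub>v R 0" by (rule eq_vecI) (auto simp: R_def)
    then have "l \<tau> (R 0) X = l \<tau> (R 0) X + 1 * l \<tau> (R 0) X" using l_line[OF R R X] by metis
    then show ?case by (simp add: l_sym[of _ X])
  next
    case (Suc n)
    have "R (Suc n) = R n + D $ n \<cdot>\<^sub>v unit_vec d n"
      using Suc.prems by (intro eq_vecI) (auto simp: R_def less_Suc_eq)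
    then have "l \<tau> (R (Suc n)) X = l \<tau> (R n) X + D $ n * l \<tau> (unit_vec d n) X"
      using l_line[OF R _ X] by simp
    then show ?case using Suc by (simp add: l_sym[of _ X])
  qed
  moreover have "R d = D" using D by (intro eq_vecI) (auto simp: R_def)
  ultimately show ?thesis by auto
qed

lemma partial_deriv_f:
  assumes X: "X \<in> carrier_vec d"
  shows "partial_deriv d f i X = - 2 * c * (\<Sum>\<tau>\<in>I. (y \<tau> - q \<tau> X) * l \<tau> X (unit_vec d i))"
proof -
  have "((\<lambda>s. c * (\<Sum>\<tau>\<in>I. (y \<tau> - (q \<tau> X + s * l \<tau> X (unit_vec d i) + s\<^sup>2 * q \<tau> (unit_vec d i)))\<^sup>2))
      has_field_derivative c * (\<Sum>\<tau>\<in>I. - 2 * ((y \<tau> - q \<tau> X) * l \<tau> X (unit_vec d i)))) (at 0)"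
    by (auto intro!: derivative_eq_intros sum.cong)
  then have "partial_deriv d f i X = c * (\<Sum>\<tau>\<in>I. - 2 * ((y \<tau> - q \<tau> X) * l \<tau> X (unit_vec d i)))"
    unfolding partial_deriv_def f using X by (simp add: q_line DERIV_imp_deriv)
  then show ?thesis by (simp add: sum_distrib_left[symmetric] sum_negf)
qed

lemma partial_deriv_partial_deriv_f:
  assumes X: "X \<in> carrier_vec d"
  shows "partial_deriv d (partial_deriv d f j) i X = 2 * c *
    (\<Sum>\<tau>\<in>I. l \<tau> X (unit_vec d i) * l \<tau> X (unit_vec d j) -
      (y \<tau> - q \<tau> X) * l \<tau> (unit_vec d i) (unit_vec d j))"
proof -
  let ?e = "unit_vec d i" and ?g = "unit_vec d j"
  have line: "partial_deriv d f j (X + s \<cdot>\<^sub>v ?e) = - 2 * c *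
      (\<Sum>\<tau>\<in>I. (y \<tau> - (q \<tau> X + s * l \<tau> X ?e + s\<^sup>2 * q \<tau> ?e)) * (l \<tau> X ?g + s * l \<tau> ?e ?g))" for s
    using X by (simp add: partial_deriv_f q_line l_line)
  have "((\<lambda>s. - 2 * c * (\<Sum>\<tau>\<in>I. (y \<tau> - (q \<tau> X + s * l \<tau> X ?e + s\<^sup>2 * q \<tau> ?e)) * (l \<tau> X ?g + s * l \<tau> ?e ?g)))
      has_field_derivative - 2 * c * (\<Sum>\<tau>\<in>I. (y \<tau> - q \<tau> X) * l \<tau> ?e ?g - l \<tau> X ?e * l \<tau> X ?g)) (at 0)"
    by (auto intro!: derivative_eq_intros sum.cong)
  then have "partial_deriv d (partial_deriv d f j) i X =
      - 2 * c * (\<Sum>\<tau>\<in>I. (y \<tau> - q \<tau> X) * l \<tau> ?e ?g - l \<tau> X ?e * l \<tau> X ?g)"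
    unfolding partial_deriv_def[of d "partial_deriv d f j"] line by (rule DERIV_imp_deriv)
  then show ?thesis by (simp add: sum_subtractf algebra_simps)
qed

lemma critical_point_first_order:
  assumes crit: "critical_point d f X" and c: "c \<noteq> 0" and D: "D \<in> carrier_vec d"
  shows "(\<Sum>\<tau>\<in>I. (y \<tau> - q \<tau> X) * l \<tau> X D) = 0"
proof -
  have X: "X \<in> carrier_vec d" using crit by (simp add: critical_point_def)
  have grad: "(\<Sum>\<tau>\<in>I. (y \<tau> - q \<tau> X) * l \<tau> X (unit_vec d i)) = 0" if "i < d" for i
  proof -
    have "gradient d f X $ i = 0" using crit that by (simp add: critical_point_def)
    then show ?thesis using that c by (simp add: gradient_def partial_deriv_f[OF X])
  qed
  have "(\<Sum>\<tau>\<in>I. (y \<tau> - q \<tau> X) * l \<tau> X D) =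
      (\<Sum>\<tau>\<in>I. \<Sum>i<d. D $ i * ((y \<tau> - q \<tau> X) * l \<tau> X (unit_vec d i)))"
    by (subst l_unit_vec_expansion[OF X D]) (simp add: sum_distrib_left mult.left_commute)
  also have "\<dots> = (\<Sum>i<d. D $ i * (\<Sum>\<tau>\<in>I. (y \<tau> - q \<tau> X) * l \<tau> X (unit_vec d i)))"
    by (subst sum.swap) (simp add: sum_distrib_left)
  also have "\<dots> = 0" by (simp add: grad)
  finally show ?thesis .
qed

text \<open>The double sum over coordinates collapses by bilinearity: the products of first
  derivatives give the square of \<open>l \<tau> X D\<close>, and the mixed terms give
  \<open>l \<tau> D D\<close>, which is twice \<open>q \<tau> D\<close>.\<close>

lemma hessian_quadratic_form:
  assumes X: "X \<in> carrier_vec d" and D: "D \<in> carrier_vec d"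
  shows "scalar_prod D (hessian d f X *\<^sub>v D) =
    2 * c * (\<Sum>\<tau>\<in>I. (l \<tau> X D)\<^sup>2 - 2 * (y \<tau> - q \<tau> X) * q \<tau> D)"
proof -
  let ?e = "unit_vec d"
  have *: "(\<Sum>i<d. \<Sum>j<d. D $ i * D $ j * (l \<tau> X (?e i) * l \<tau> X (?e j) - (y \<tau> - q \<tau> X) * l \<tau> (?e i) (?e j))) =
      (l \<tau> X D)\<^sup>2 - 2 * (y \<tau> - q \<tau> X) * q \<tau> D" for \<tau>
  proof -
    have 1: "(\<Sum>i<d. \<Sum>j<d. D $ i * D $ j * (l \<tau> X (?e i) * l \<tau> X (?e j))) = (l \<tau> X D)\<^sup>2"
      unfolding l_unit_vec_expansion[OF X D] power2_eq_square sum_product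
      by (simp add: mult_ac)
    have "l \<tau> D D = (\<Sum>i<d. D $ i * l \<tau> (?e i) D)"
      by (subst l_unit_vec_expansion[OF D D]) (simp only: l_sym[of _ D])
    also have "\<dots> = (\<Sum>i<d. \<Sum>j<d. D $ i * D $ j * l \<tau> (?e i) (?e j))"
      by (simp only: l_unit_vec_expansion[OF unit_vec_carrier D] sum_distrib_left mult.assoc)
    finally have 2: "(\<Sum>i<d. \<Sum>j<d. D $ i * D $ j * l \<tau> (?e i) (?e j)) = 2 * q \<tau> D"
      by (simp add: l_diag)
    have "(\<Sum>i<d. \<Sum>j<d. D $ i * D $ j * (l \<tau> X (?e i) * l \<tau> X (?e j) - (y \<tau> - q \<tau> X) * l \<tau> (?e i) (?e j))) =
      (\<Sum>i<d. \<Sum>j<d. D $ i * D $ j * (l \<tau> X (?e i) * l \<tau> X (?e j))) -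
      (y \<tau> - q \<tau> X) * (\<Sum>i<d. \<Sum>j<d. D $ i * D $ j * l \<tau> (?e i) (?e j))"
      unfolding sum_distrib_left sum_subtractf[symmetric]
      by (intro sum.cong refl) (simp add: right_diff_distrib mult.left_commute)
    then show ?thesis unfolding 1 2 by (simp only: mult_ac)
  qed
  have "scalar_prod D (hessian d f X *\<^sub>v D) = (\<Sum>i<d. \<Sum>j<d. \<Sum>\<tau>\<in>I. 2 * c *
      (D $ i * D $ j * (l \<tau> X (?e i) * l \<tau> X (?e j) - (y \<tau> - q \<tau> X) * l \<tau> (?e i) (?e j))))"
    using D
    by (simp add: scalar_prod_def hessian_def partial_deriv_partial_deriv_f[OF X] lessThan_atLeast0
        sum_distrib_left sum_distrib_right mult_ac)
  also have "\<dots> = (\<Sum>\<tau>\<in>I. 2 * c * (\<Sum>i<d. \<Sum>j<d.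
      D $ i * D $ j * (l \<tau> X (?e i) * l \<tau> X (?e j) - (y \<tau> - q \<tau> X) * l \<tau> (?e i) (?e j))))"
    unfolding sum_distrib_left
    by (rule trans, rule sum.cong[OF refl], rule sum.swap, rule sum.swap)
  finally show ?thesis unfolding * by (simp only: sum_distrib_left)
qed

text \<open>The explicit second partial derivatives are symmetric in the two indices, so the sign of
  the least eigenvalue controls the quadratic form of the Hessian.\<close>

lemma local_minimum_second_order:
  assumes loc: "local_minimum d f X" and c: "c > 0" and D: "D \<in> carrier_vec d"
  shows "0 \<le> (\<Sum>\<tau>\<in>I. (l \<tau> X D)\<^sup>2 - 2 * (y \<tau> - q \<tau> X) * q \<tau> D)"
proof -
  have X: "X \<in> carrier_vec d" using loc by (simp add: local_minimum_def critical_point_def)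
  have "partial_deriv d (partial_deriv d f j) i X = partial_deriv d (partial_deriv d f i) j X" for i j
    unfolding partial_deriv_partial_deriv_f[OF X] l_sym[of _ "unit_vec d i" "unit_vec d j"]
    by (simp only: mult.commute)
  then have "(hessian d f X)\<^sup>T = hessian d f X"
    by (intro eq_matI) (simp_all add: hessian_def)
  then have "pos_semidef d (hessian d f X)"
    using loc by (intro lambda_min_nonneg_imp_psd) (auto simp: local_minimum_def hessian_def)
  then have "scalar_prod D (hessian d f X *\<^sub>v D) \<ge> 0" using D by (simp add: pos_semidef_def)
  then show ?thesis using c unfolding hessian_quadratic_form[OF X D] by (simp add: zero_le_mult_iff)
qed

end

subsection \<open>The regression landscape\<close>

lemma l2_norm_power2: "(l2_norm v)\<^sup>2 = scalar_prod v v"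
  by (simp add: l2_norm_def scalar_prod_self_nonneg)

lemma row_major_index_less: "j < h \<Longrightarrow> b < k \<Longrightarrow> j * k + b < h * (k :: nat)"
  using mult_le_mono1[of "Suc j" h k] by simp

text \<open>Each fitted value, indexed by a time \<open>t\<close> and a coordinate \<open>a\<close>,
  is bilinear in the two factors and hence quadratic in the vector of all entries. The conditions of
  \<open>quadratic_residuals\<close> are then read off in directions with freely prescribed
  factors.\<close>

lemma factored_least_squares_local_minimum_global:
  fixes yv z :: "'t \<Rightarrow> real vec"
  assumes S: "finite S" and h: "h \<ge> 1" and c: "c > 0"
    and yv: "\<And>t. t \<in> S \<Longrightarrow> yv t \<in> carrier_vec Q" and z: "\<And>t. t \<in> S \<Longrightarrow> z t \<in> carrier_vec k"
    and d: "d = h * k + Q * h"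
    and f: "\<And>X. f X = c *
      (\<Sum>t\<in>S. (l2_norm (yv t - (second_factor h k Q X * first_factor h k X) *\<^sub>v z t))\<^sup>2)"
    and loc: "local_minimum d f X"
  shows "global_minimum d f X"
proof -
  define g\<^sub>1 :: "real vec \<Rightarrow> nat \<Rightarrow> nat \<Rightarrow> real" where "g\<^sub>1 X j b = X $ (j * k + b)" for X j b
  \<comment> \<open>The column index \<open>j\<close> comes first. The value 0 for
    \<open>a \<ge> Q\<close> makes the line expansions hold for every index, also where the position
    may lie beyond the end of the vector.\<close>
  define g\<^sub>2 :: "real vec \<Rightarrow> nat \<Rightarrow> nat \<Rightarrow> real"
    where "g\<^sub>2 X j a = (if a < Q then X $ (h * k + a * h + j) else 0)" for X j a
  define x where "x X j t = (\<Sum>b<k. g\<^sub>1 X j b * z t $ b)" for X j t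
  define q where "q = (\<lambda>(t, a) X. \<Sum>j<h. g\<^sub>2 X j a * x X j t)"
  define l where "l = (\<lambda>(t, a) X D. \<Sum>j<h. g\<^sub>2 X j a * x D j t + g\<^sub>2 D j a * x X j t)"
  define I where "I = S \<times> {..<Q}"
  have idx1: "j * k + b < d" if "j < h" "b < k" for j b
    using row_major_index_less[OF that] by (simp add: d)
  have idx2: "h * k + a * h + j < d" if "j < h" "a < Q" for j a
    using row_major_index_less[OF that(2,1)] by (simp add: d)
  have g1_line: "g\<^sub>1 (X + s \<cdot>\<^sub>v D) j b = g\<^sub>1 X j b + s * g\<^sub>1 D j b"
    if "X \<in> carrier_vec d" "D \<in> carrier_vec d" "j < h" "b < k" for X D s j b
    using that idx1[of j b] by (auto simp: g\<^sub>1_def)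
  have g2_line: "g\<^sub>2 (X + s \<cdot>\<^sub>v D) j a = g\<^sub>2 X j a + s * g\<^sub>2 D j a"
    if "X \<in> carrier_vec d" "D \<in> carrier_vec d" "j < h" for X D s j a
    using that idx2[of j a] by (auto simp: g\<^sub>2_def)
  have x_line: "x (X + s \<cdot>\<^sub>v D) j t = x X j t + s * x D j t"
    if "X \<in> carrier_vec d" "D \<in> carrier_vec d" "j < h" for X D s j t
    using that by (simp add: x_def g1_line distrib_right sum.distrib sum_distrib_left mult.assoc)
  have fit: "((second_factor h k Q X * first_factor h k X) *\<^sub>v z t) $ a = q (t, a) X"
    if "t \<in> S" "a < Q" for X t a
  proof -
    have carr: "second_factor h k Q X \<in> carrier_mat Q h" "first_factor h k X \<in> carrier_mat h k"
      by (simp_all add: second_factor_def first_factor_def)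
    have "(second_factor h k Q X * first_factor h k X) *\<^sub>v z t =
        second_factor h k Q X *\<^sub>v (first_factor h k X *\<^sub>v z t)"
      using assoc_mult_mat_vec[OF carr z[OF that(1)]] .
    then show ?thesis
      using that z[OF that(1)]
      by (simp add: q_def x_def g\<^sub>1_def g\<^sub>2_def second_factor_def first_factor_def scalar_prod_def lessThan_atLeast0)
  qed
  have f_I: "f X = c * (\<Sum>\<tau>\<in>I. (yv (fst \<tau>) $ snd \<tau> - q \<tau> X)\<^sup>2)" for X
  proof -
    have "(l2_norm (yv t - (second_factor h k Q X * first_factor h k X) *\<^sub>v z t))\<^sup>2 =
        (\<Sum>a<Q. (yv t $ a - q (t, a) X)\<^sup>2)" if "t \<in> S" for t
      unfolding l2_norm_power2 using yv[OF that] fit[OF that]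
      by (simp add: scalar_prod_def power2_eq_square lessThan_atLeast0 second_factor_def)
    then show ?thesis unfolding f I_def by (simp add: sum.cartesian_product')
  qed
  interpret quadratic_residuals d I q l f c "\<lambda>\<tau>. yv (fst \<tau>) $ snd \<tau>"
  proof
    fix \<tau> :: "'t \<times> nat" and X D E :: "real vec" and s :: real
    obtain t a where \<tau>: "\<tau> = (t, a)" by force
    show "l \<tau> X D = l \<tau> D X" by (simp add: \<tau> l_def add.commute)
    show "l \<tau> D D = 2 * q \<tau> D" by (simp add: \<tau> l_def q_def sum_distrib_left)
    show "f X = c * (\<Sum>\<tau>\<in>I. (yv (fst \<tau>) $ snd \<tau> - q \<tau> X)\<^sup>2)" by (rule f_I)
    assume XD: "X \<in> carrier_vec d" "D \<in> carrier_vec d"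
    show "q \<tau> (X + s \<cdot>\<^sub>v D) = q \<tau> X + s * l \<tau> X D + s\<^sup>2 * q \<tau> D"
      unfolding \<tau> q_def l_def prod.case sum_distrib_left sum.distrib[symmetric]
      using XD by (intro sum.cong refl) (simp add: g2_line x_line power2_eq_square algebra_simps)
    show "l \<tau> (X + s \<cdot>\<^sub>v D) E = l \<tau> X E + s * l \<tau> D E"
      unfolding \<tau> l_def prod.case sum_distrib_left sum.distrib[symmetric]
      using XD by (intro sum.cong refl) (simp add: g2_line x_line algebra_simps)
  qed
  have X: "X \<in> carrier_vec d" using loc by (simp add: local_minimum_def critical_point_def)
  define r where "r a t = yv t $ a - (\<Sum>j<h. g\<^sub>2 X j a * x X j t)" for a t
  have r_q: "yv t $ a - q (t, a) X = r a t" for a t by (simp add: r_def q_def)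
  \<comment> \<open>Inverse of the row-major encoding: the vector with prescribed entries of both
    factors. \<open>D\<^sub>2\<close> takes the column before the row, in accordance with
    \<open>g\<^sub>2\<close>.\<close>
  define dir where "dir D\<^sub>1 D\<^sub>2 = vec d (\<lambda>i. if i < h * k then D\<^sub>1 (i div k) (i mod k)
    else D\<^sub>2 ((i - h * k) mod h) ((i - h * k) div h))" for D\<^sub>1 D\<^sub>2 :: "nat \<Rightarrow> nat \<Rightarrow> real"
  have dir: "dir D\<^sub>1 D\<^sub>2 \<in> carrier_vec d" for D\<^sub>1 D\<^sub>2 by (simp add: dir_def)
  have g1_dir: "g\<^sub>1 (dir D\<^sub>1 D\<^sub>2) j b = D\<^sub>1 j b" if "j < h" "b < k" for D\<^sub>1 D\<^sub>2 j b
    using that idx1[OF that] row_major_index_less[OF that] by (simp add: g\<^sub>1_def dir_def)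
  have g2_dir: "g\<^sub>2 (dir D\<^sub>1 D\<^sub>2) j a = D\<^sub>2 j a" if "j < h" "a < Q" for D\<^sub>1 D\<^sub>2 j a
    using that idx2[OF that] by (simp add: g\<^sub>2_def dir_def add.assoc)
  have x_dir: "x (dir D\<^sub>1 D\<^sub>2) j t = (\<Sum>b<k. D\<^sub>1 j b * z t $ b)" if "j < h" for D\<^sub>1 D\<^sub>2 j t
    using that by (simp add: x_def g1_dir)
  have l_dir: "l (t, a) X (dir D\<^sub>1 D\<^sub>2) =
      (\<Sum>j<h. g\<^sub>2 X j a * (\<Sum>b<k. D\<^sub>1 j b * z t $ b) + D\<^sub>2 j a * x X j t)" if "a < Q" for t a D\<^sub>1 D\<^sub>2
    using that by (simp add: l_def x_dir g2_dir)
  have q_dir: "q (t, a) (dir D\<^sub>1 D\<^sub>2) = (\<Sum>j<h. D\<^sub>2 j a * (\<Sum>b<k. D\<^sub>1 j b * z t $ b))"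
    if "a < Q" for t a D\<^sub>1 D\<^sub>2
    using that by (simp add: q_def x_dir g2_dir)
  have first: "(\<Sum>t\<in>S. \<Sum>a<Q. r a t *
      (\<Sum>j<h. g\<^sub>2 X j a * (\<Sum>b<k. D\<^sub>1 j b * z t $ b) + D\<^sub>2 j a * x X j t)) = 0" for D\<^sub>1 D\<^sub>2
    using critical_point_first_order[OF _ _ dir, of X D\<^sub>1 D\<^sub>2] loc c
    by (simp add: local_minimum_def I_def sum.cartesian_product' r_q l_dir)
  have second: "(\<Sum>t\<in>S. \<Sum>a<Q.
      (\<Sum>j<h. g\<^sub>2 X j a * (\<Sum>b<k. D\<^sub>1 j b * z t $ b) + D\<^sub>2 j a * x X j t)\<^sup>2 -
      2 * r a t * (\<Sum>j<h. D\<^sub>2 j a * (\<Sum>b<k. D\<^sub>1 j b * z t $ b))) \<ge> 0" for D\<^sub>1 D\<^sub>2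
  proof -
    have "0 \<le> (\<Sum>t\<in>S. \<Sum>a<Q. (l (t, a) X (dir D\<^sub>1 D\<^sub>2))\<^sup>2 -
        2 * r a t * q (t, a) (dir D\<^sub>1 D\<^sub>2))"
      using local_minimum_second_order[OF loc c dir, of D\<^sub>1 D\<^sub>2]
      unfolding I_def sum.cartesian_product' fst_conv snd_conv r_q .
    also have "\<dots> = (\<Sum>t\<in>S. \<Sum>a<Q.
        (\<Sum>j<h. g\<^sub>2 X j a * (\<Sum>b<k. D\<^sub>1 j b * z t $ b) + D\<^sub>2 j a * x X j t)\<^sup>2 -
        2 * r a t * (\<Sum>j<h. D\<^sub>2 j a * (\<Sum>b<k. D\<^sub>1 j b * z t $ b)))"
      by (intro sum.cong refl) (simp only: l_dir q_dir lessThan_iff)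
    finally show ?thesis .
  qed
  have "f X \<le> f Y" for Y
  proof -
    have "(\<Sum>t\<in>S. \<Sum>a<Q. (r a t)\<^sup>2) \<le>
        (\<Sum>t\<in>S. \<Sum>a<Q. (yv t $ a - (\<Sum>j<h. g\<^sub>2 Y j a * (\<Sum>b<k. g\<^sub>1 Y j b * z t $ b)))\<^sup>2)"
      by (rule second_order_imp_global_factorization[OF _ S h x_def r_def first second]) simp
    then show ?thesis
      using c unfolding f_I I_def
      by (simp add: sum.cartesian_product' r_def q_def x_def[of Y])
  qed
  with X show ?thesis by (simp add: global_minimum_def)
qed

lemma regression_loss_local_minimum_global:
  assumes h: "h \<ge> 1" and T: "T \<ge> 1"
    and "local_minimum (h * ((m + p) * L) + (m * H) * h)
      (\<lambda>X. regression_loss m p H L T y u (first_factor h ((m + p) * L) X)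
        (second_factor h ((m + p) * L) (m * H) X)) X"
  shows "global_minimum (h * ((m + p) * L) + (m * H) * h)
      (\<lambda>X. regression_loss m p H L T y u (first_factor h ((m + p) * L) X)
        (second_factor h ((m + p) * L) (m * H) X)) X"
proof (rule factored_least_squares_local_minimum_global[OF _ h _ _ _ refl _ assms(3),
      where S = "{1..T}" and yv = "stacked m H y" and z = "covariate m p L y u"])
  show "0 < 1 / (2 * real T)" using T by simp
  show "stacked m H y t \<in> carrier_vec (m * H)" for t by (simp add: stacked_def)
  show "covariate m p L y u t \<in> carrier_vec ((m + p) * L)" for t
    unfolding covariate_def distrib_right by (intro append_carrier_vec) (simp_all add: lagged_def)
qed (simp_all add: regression_loss_def)

theorem proposition2:
  shows "\<exists>c\<^sub>1 > 0. \<exists>c\<^sub>2 > 0.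
    \<forall>(M :: 'w measure) (n :: nat) (m :: nat) (p :: nat) A B C S\<^sub>w S\<^sub>v S\<^sub>u S x u w v y
      (H :: nat) (r :: nat) (L :: nat) (T :: nat) (h :: nat)
      (\<beta> :: real) (\<rho> :: real) (\<delta> :: real).
      prob_space M \<longrightarrow>
      n \<ge> 1 \<longrightarrow> m \<ge> 1 \<longrightarrow> p \<ge> 1 \<longrightarrow> H \<ge> 1 \<longrightarrow> r \<ge> 1 \<longrightarrow> L \<ge> 1 \<longrightarrow> T \<ge> 1 \<longrightarrow>
      A \<in> carrier_mat n n \<longrightarrow> B \<in> carrier_mat n p \<longrightarrow> C \<in> carrier_mat m n \<longrightarrow>
      riccati_solution n A C S\<^sub>w S\<^sub>v S \<longrightarrow>
      gaussian_sources M n m p S S\<^sub>w S\<^sub>v S\<^sub>u (x 0) w v u \<longrightarrow>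
      linear_system M A B C x u w v y \<longrightarrow>
      real_spectral_radius A \<le> 1 \<longrightarrow>
      stabilizable n A (psd_sqrt n S\<^sub>w) \<longrightarrow>
      observable n m A C \<longrightarrow>
      (let F = kalman_gain A C S\<^sub>v S;
           Abar = A - F * C;
           S\<^sub>e = innovation_cov C S\<^sub>v S;
           cov_xhat = (\<lambda>t. cov_mat M n
             (\<lambda>\<omega>. kalman_state n Abar B F (\<lambda>s. u s \<omega>) (\<lambda>s. y s \<omega>) t));
           cov_zbar = (\<lambda>t. cov_mat M ((m + p) * L)
             (\<lambda>\<omega>. covariate m p L (\<lambda>s. y s \<omega>) (\<lambda>s. u s \<omega>) t));
           C_zbar = real ((m + p) * L) *
             (spectral_norm (C * cov_xhat T * C\<^sup>T + S\<^sub>e) + spectral_norm S\<^sub>u);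
           C_xhat = real n * spectral_norm (cov_xhat T);
           d = h * ((m + p) * L) + (m * H) * h;
           loss = (\<lambda>\<omega> X. regression_loss m p H L T (\<lambda>s. y s \<omega>) (\<lambda>s. u s \<omega>)
             (first_factor h ((m + p) * L) X) (second_factor h ((m + p) * L) (m * H) X))
       in 0 < \<delta> \<longrightarrow> \<delta> < 1 \<longrightarrow>
          real_spectral_radius Abar < \<rho> \<longrightarrow> \<rho> < 1 \<longrightarrow>
          \<beta> > 0 \<longrightarrow>
          real L \<ge> c\<^sub>1 * (\<beta> * ln (power_bound Abar \<rho> * real T * spectral_norm C *
                               sqrt (C_zbar * C_xhat)) / (1 - \<rho>)) \<longrightarrow>
          real T \<ge> c\<^sub>2 * (real L *
             (real ((m + p) * L) *
                ln (2 * real T * spectral_norm (cov_zbar T) /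
                    (3 * real L * lambda_min (cov_zbar L)))
              + ln (1 / \<delta>))) \<longrightarrow>
          1 \<le> h \<longrightarrow> h \<le> r \<longrightarrow>
          measure M {\<omega> \<in> space M.
            (\<forall>X. local_minimum d (loss \<omega>) X \<longrightarrow> global_minimum d (loss \<omega>) X) \<and>
            (\<forall>X. saddle_point d (loss \<omega>) X \<longrightarrow> strict_saddle_point d (loss \<omega>) X)} \<ge> 1 - \<delta>)"
proof (rule exI[of _ 1], rule conjI, simp, rule exI[of _ 1], rule conjI, simp,
    intro allI impI, unfold Let_def, intro impI)
  fix M :: "'w measure" and n m p :: nat and A B C S\<^sub>w S\<^sub>v S\<^sub>u S :: "real mat"
    and x u w v y :: "nat \<Rightarrow> 'w \<Rightarrow> real vec" and H r L T h :: nat and \<beta> \<rho> \<delta> :: real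
  assume "prob_space M" and T: "T \<ge> 1" and \<delta>: "0 < \<delta>" and h: "1 \<le> h"
  then interpret prob_space M by simp
  let ?d = "h * ((m + p) * L) + (m * H) * h"
  let ?loss = "\<lambda>\<omega> X. regression_loss m p H L T (\<lambda>s. y s \<omega>) (\<lambda>s. u s \<omega>)
    (first_factor h ((m + p) * L) X) (second_factor h ((m + p) * L) (m * H) X)"
  have "global_minimum ?d (?loss \<omega>) X" if "local_minimum ?d (?loss \<omega>) X" for \<omega> X
    by (rule regression_loss_local_minimum_global[OF h T that])
  moreover have "strict_saddle_point ?d (?loss \<omega>) X" if "saddle_point ?d (?loss \<omega>) X" for \<omega> X
    using that by (auto simp: saddle_point_def strict_saddle_point_def local_minimum_def)
  \<comment> \<open>Equality with \<open>space M\<close> settles the measurability of the event as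
    well as its probability.\<close>
  ultimately have "{\<omega> \<in> space M.
      (\<forall>X. local_minimum ?d (?loss \<omega>) X \<longrightarrow> global_minimum ?d (?loss \<omega>) X) \<and>
      (\<forall>X. saddle_point ?d (?loss \<omega>) X \<longrightarrow> strict_saddle_point ?d (?loss \<omega>) X)} = space M"
    by blast
  then show "1 - \<delta> \<le> measure M {\<omega> \<in> space M.
      (\<forall>X. local_minimum ?d (?loss \<omega>) X \<longrightarrow> global_minimum ?d (?loss \<omega>) X) \<and>
      (\<forall>X. saddle_point ?d (?loss \<omega>) X \<longrightarrow> strict_saddle_point ?d (?loss \<omega>) X)}"
    using \<delta> by (simp only: prob_space)
qed

end
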